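(* Let $\Delta$ be the polar building of one of the types $B_n(\mathbb{F})$, $C_n(\mathbb{F})$ with $\operatorname{Char}(\mathbb{F})\ne 2$, ${}^2A_{2n}(\mathbb{F})$, ${}^2A_{2n+1}(\mathbb{F})$, or ${}^2D_{n+1}(\mathbb{F})$, where $n\ge 3$, let $1\le k\le n$, and let $\Gamma$ be the polar $k$-Grassmannian of $\Delta$. If $\Gamma$ is not of type $B_{4,2}(\mathbb{F})$ or ${}^2D_{5,2}(\mathbb{F})$, then $\operatorname{Aut}(\Gamma)\cong\operatorname{Aut}(\Delta)$.
   Context: Forms. $W$ is a finite-dimensional vector space over a field $\mathbb{F}$ with a non-degenerate form of Witt index $n\ge 3$, as follows. $B_n$: parabolic quadratic form, $\dim W=2n+1$, any characteristic. $C_n$: symplectic form, $\dim W=2n$, $\operatorname{Char}(\mathbb{F})\ne 2$. ${}^2A_{2n}$ and ${}^2A_{2n+1}$: $\sigma$-hermitian form with $\dim W=2n$, respectively $2n+1$, where $\sigma\in\operatorname{Aut}(\mathbb{F})$ has order $2$, $\mathbb{F}$ is a quadratic extension of the fixed field $\mathbb{F}^\sigma$, and the norm $N_\sigma:\mathbb{F}\to\mathbb{F}^\sigma$ is surjective. ${}^2D_{n+1}$: elliptic quadratic form, $\dim W=2n+2$, any characteristic. "Totally isotropic" means totally isotropic for the form (totally singular for the quadratic form in the orthogonal cases), and $\perp$ is taken with respect to the sesquilinear form (the associated bilinear form in the orthogonal cases). Polar building $\Delta$. The incidence geometry whose $i$-objects ($1\le i\le n$) are the totally isotropic $i$-spaces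 of $W$, with incidence given by containment. $\operatorname{Aut}(\Delta)$ is its group of (type-preserving) automorphisms. Polar $k$-Grassmannian $\Gamma$ (of type $M_{n,k}(\mathbb{F})$ when $\Delta$ has type $M_n(\mathbb{F})$; its type is written $B_{n,k}$, $C_{n,k}$, ${}^2A_{2n,k}$, ${}^2A_{2n+1,k}$, ${}^2D_{n+1,k}$ respectively). The point-line geometry whose points are the totally isotropic $k$-spaces of $W$. If $k<n$, its lines are the sets of all totally isotropic $k$-spaces $B$ with $A\subset B\subset C$, where $A\subset C$ are totally isotropic of dimensions $k-1$ and $k+1$. If $k=n$, its lines are the sets of all totally isotropic $n$-spaces containing a given totally isotropic $(n-1)$-space $A$. $\operatorname{Aut}(\Gamma)$ is the group of automorphisms of this point-line geometry (bijections of the point set inducing a bijection of the line set). *)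

theory Defs
  imports Complex_Main "HOL-Algebra.Bij"
begin

section \<open>Forms\<close>

text \<open>
  A vector space over the field \<open>'f\<close> is the type \<open>'w\<close> together with a scalar multiplication
  \<open>scale\<close>, as in the locale \<^locale>\<open>vector_space\<close>.
\<close>

definition field_automorphism :: "('f::field \<Rightarrow> 'f) \<Rightarrow> bool" where
  "field_automorphism \<sigma> \<longleftrightarrow>
     bij \<sigma> \<and> \<sigma> 1 = 1 \<and> (\<forall>a b. \<sigma> (a + b) = \<sigma> a + \<sigma> b) \<and> (\<forall>a b. \<sigma> (a * b) = \<sigma> a * \<sigma> b)"

definition fixed_field :: "('f::field \<Rightarrow> 'f) \<Rightarrow> 'f set" where
  "fixed_field \<sigma> = {a. \<sigma> a = a}"

definition involutory_automorphism :: "('f::field \<Rightarrow> 'f) \<Rightarrow> bool" where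
  "involutory_automorphism \<sigma> \<longleftrightarrow> field_automorphism \<sigma> \<and> \<sigma> \<noteq> id \<and> \<sigma> \<circ> \<sigma> = id"

definition norm_surjective :: "('f::field \<Rightarrow> 'f) \<Rightarrow> bool" where
  "norm_surjective \<sigma> \<longleftrightarrow> (\<lambda>a. a * \<sigma> a) ` UNIV = fixed_field \<sigma>"

text \<open>
  The field is automatically a quadratic extension of the fixed field of an automorphism of
  order 2: there is a basis \<open>{1, t}\<close>.
\<close>

lemma quadratic_over_fixed_field:
  assumes "involutory_automorphism \<sigma>"
  shows "\<exists>t. \<forall>x. \<exists>!p. p \<in> fixed_field \<sigma> \<times> fixed_field \<sigma> \<and> x = fst p + snd p * t"
proof -
  have add: "\<sigma> (a + b) = \<sigma> a + \<sigma> b" and mult: "\<sigma> (a * b) = \<sigma> a * \<sigma> b" for a b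
    using assms by (auto simp: involutory_automorphism_def field_automorphism_def)
  have one: "\<sigma> 1 = 1" and invol: "\<sigma> (\<sigma> a) = a" for a
    using assms
    by (auto simp: involutory_automorphism_def field_automorphism_def fun_eq_iff)
  have zero: "\<sigma> 0 = 0" using add[of 0 0] by (metis add_0_right add_left_cancel)
  have diff: "\<sigma> (a - b) = \<sigma> a - \<sigma> b" for a b
    using add[of "a - b" b] by (simp add: algebra_simps)
  have inv: "\<sigma> (inverse a) = inverse (\<sigma> a)" for a
  proof (cases "a = 0")
    case False
    then have "\<sigma> a * \<sigma> (inverse a) = 1"
      using mult[of a "inverse a"] one by simp
    then show ?thesis by (metis inverse_unique)
  qed (simp add: zero)
  have "\<exists>t. \<sigma> t \<noteq> t"
    using assms by (auto simp: involutory_automorphism_def fun_eq_iff)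
  then obtain t where t: "\<sigma> t \<noteq> t" ..
  have "\<exists>!p. p \<in> fixed_field \<sigma> \<times> fixed_field \<sigma> \<and> x = fst p + snd p * t" for x
  proof -
    define b where "b = (x - \<sigma> x) * inverse (t - \<sigma> t)"
    have "\<sigma> b = (\<sigma> x - x) * inverse (\<sigma> t - t)"
      by (simp add: b_def mult diff inv invol)
    also have "\<dots> = b"
      using t by (simp add: b_def field_simps)
    finally have b: "\<sigma> b = b" .
    have "b * (t - \<sigma> t) = x - \<sigma> x"
      using t by (simp add: b_def)
    then have a: "\<sigma> (x - b * t) = x - b * t"
      by (simp add: diff mult b algebra_simps)
    have uniq: "c = x - b * t \<and> d = b"
      if "\<sigma> c = c" "\<sigma> d = d" "x = c + d * t" for c d
    proof -
      have "\<sigma> x = c + d * \<sigma> t" using that by (simp add: add mult)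
      with that have "x - \<sigma> x = d * (t - \<sigma> t)" by (simp add: algebra_simps)
      then have "d = b" using t by (simp add: b_def)
      with that show ?thesis by simp
    qed
    show ?thesis
    proof (rule ex1I[of _ "(x - b * t, b)"])
      show "(x - b * t, b) \<in> fixed_field \<sigma> \<times> fixed_field \<sigma> \<and>
            x = fst (x - b * t, b) + snd (x - b * t, b) * t"
        using a b by (simp add: fixed_field_def)
    next
      fix p assume "p \<in> fixed_field \<sigma> \<times> fixed_field \<sigma> \<and> x = fst p + snd p * t"
      then show "p = (x - b * t, b)"
        using uniq[of "fst p" "snd p"] by (cases p) (auto simp: fixed_field_def)
    qed
  qed
  then show ?thesis by blast
qed

definition sesquilinear ::
  "('f::field \<Rightarrow> 'w::ab_group_add \<Rightarrow> 'w) \<Rightarrow> ('f \<Rightarrow> 'f) \<Rightarrow> ('w \<Rightarrow> 'w \<Rightarrow> 'f) \<Rightarrow> bool" where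
  "sesquilinear scale \<sigma> f \<longleftrightarrow>
     (\<forall>x y z. f (x + y) z = f x z + f y z) \<and> (\<forall>x y z. f x (y + z) = f x y + f x z) \<and>
     (\<forall>c x y. f (scale c x) y = c * f x y) \<and> (\<forall>c x y. f x (scale c y) = \<sigma> c * f x y)"

definition nondegenerate :: "('w::ab_group_add \<Rightarrow> 'w \<Rightarrow> 'f::field) \<Rightarrow> bool" where
  "nondegenerate f \<longleftrightarrow> (\<forall>x. (\<forall>y. f x y = 0) \<longrightarrow> x = 0)"

definition alternating_form ::
  "('f::field \<Rightarrow> 'w::ab_group_add \<Rightarrow> 'w) \<Rightarrow> ('w \<Rightarrow> 'w \<Rightarrow> 'f) \<Rightarrow> bool" where
  "alternating_form scale f \<longleftrightarrow> sesquilinear scale id f \<and> (\<forall>x. f x x = 0)"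

definition hermitian_form ::
  "('f::field \<Rightarrow> 'w::ab_group_add \<Rightarrow> 'w) \<Rightarrow> ('f \<Rightarrow> 'f) \<Rightarrow> ('w \<Rightarrow> 'w \<Rightarrow> 'f) \<Rightarrow> bool" where
  "hermitian_form scale \<sigma> f \<longleftrightarrow> sesquilinear scale \<sigma> f \<and> (\<forall>x y. f y x = \<sigma> (f x y))"

definition associated_bilinear :: "('w::ab_group_add \<Rightarrow> 'f::field) \<Rightarrow> 'w \<Rightarrow> 'w \<Rightarrow> 'f" where
  "associated_bilinear q x y = q (x + y) - q x - q y"

definition quadratic_form ::
  "('f::field \<Rightarrow> 'w::ab_group_add \<Rightarrow> 'w) \<Rightarrow> ('w \<Rightarrow> 'f) \<Rightarrow> bool" where
  "quadratic_form scale q \<longleftrightarrow>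
     (\<forall>c x. q (scale c x) = c\<^sup>2 * q x) \<and> sesquilinear scale id (associated_bilinear q)"

text \<open>
  Non-degeneracy of a quadratic form means that the radical of the associated bilinear form
  contains no non-zero singular vector. In characteristic 2 this is weaker than non-degeneracy of
  the bilinear form, which never holds in odd dimension.
\<close>

definition nondegenerate_quadratic :: "('w::ab_group_add \<Rightarrow> 'f::field) \<Rightarrow> bool" where
  "nondegenerate_quadratic q \<longleftrightarrow>
     (\<forall>x. (\<forall>y. associated_bilinear q x y = 0) \<longrightarrow> q x = 0 \<longrightarrow> x = 0)"

datatype ('f, 'w) form =
    Quadratic "'w \<Rightarrow> 'f"
  | Sesquilinear "'w \<Rightarrow> 'w \<Rightarrow> 'f"

fun totally_isotropic :: "('f::field, 'w) form \<Rightarrow> 'w set \<Rightarrow> bool" where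
  "totally_isotropic (Quadratic q) U \<longleftrightarrow> (\<forall>x\<in>U. q x = 0)"
| "totally_isotropic (Sesquilinear f) U \<longleftrightarrow> (\<forall>x\<in>U. \<forall>y\<in>U. f x y = 0)"

definition isotropic_spaces ::
  "('f::field \<Rightarrow> 'w::ab_group_add \<Rightarrow> 'w) \<Rightarrow> ('f, 'w) form \<Rightarrow> nat \<Rightarrow> 'w set set" where
  "isotropic_spaces scale \<phi> i =
     {U. module.subspace scale U \<and> totally_isotropic \<phi> U \<and> vector_space.dim scale U = i}"

definition witt_index ::
  "('f::field \<Rightarrow> 'w::ab_group_add \<Rightarrow> 'w) \<Rightarrow> ('f, 'w) form \<Rightarrow> nat" where
  "witt_index scale \<phi> = Max {i. isotropic_spaces scale \<phi> i \<noteq> {}}"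

text \<open>
  The types \<open>B\<^sub>n\<close>, \<open>C\<^sub>n\<close>, \<open>\<^sup>2A\<^sub>2\<^sub>n\<close> and \<open>\<^sup>2A\<^sub>2\<^sub>n\<^sub>+\<^sub>1\<close> (hermitian of even and of odd dimension),
  and \<open>\<^sup>2D\<^sub>n\<^sub>+\<^sub>1\<close>.
\<close>

datatype polar_type = Parabolic | Symplectic | Hermitian_even | Hermitian_odd | Elliptic

fun form_of_type ::
  "('f::field \<Rightarrow> 'w::ab_group_add \<Rightarrow> 'w) \<Rightarrow> polar_type \<Rightarrow> nat \<Rightarrow> ('f, 'w) form \<Rightarrow> bool" where
  "form_of_type scale Parabolic n \<phi> \<longleftrightarrow>
     vector_space.dim scale (UNIV :: 'w set) = 2 * n + 1 \<and>
     (\<exists>q. \<phi> = Quadratic q \<and> quadratic_form scale q \<and> nondegenerate_quadratic q)"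
| "form_of_type scale Symplectic n \<phi> \<longleftrightarrow>
     vector_space.dim scale (UNIV :: 'w set) = 2 * n \<and> CHAR('f) \<noteq> 2 \<and>
     (\<exists>f. \<phi> = Sesquilinear f \<and> alternating_form scale f \<and> nondegenerate f)"
| "form_of_type scale Hermitian_even n \<phi> \<longleftrightarrow>
     vector_space.dim scale (UNIV :: 'w set) = 2 * n \<and>
     (\<exists>\<sigma> f. \<phi> = Sesquilinear f \<and> involutory_automorphism \<sigma> \<and> norm_surjective \<sigma> \<and>
            hermitian_form scale \<sigma> f \<and> nondegenerate f)"
| "form_of_type scale Hermitian_odd n \<phi> \<longleftrightarrow>
     vector_space.dim scale (UNIV :: 'w set) = 2 * n + 1 \<and>
     (\<exists>\<sigma> f. \<phi> = Sesquilinear f \<and> involutory_automorphism \<sigma> \<and> norm_surjective \<sigma> \<and>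
            hermitian_form scale \<sigma> f \<and> nondegenerate f)"
| "form_of_type scale Elliptic n \<phi> \<longleftrightarrow>
     vector_space.dim scale (UNIV :: 'w set) = 2 * n + 2 \<and>
     (\<exists>q. \<phi> = Quadratic q \<and> quadratic_form scale q \<and> nondegenerate_quadratic q)"

definition polar_form ::
  "('f::field \<Rightarrow> 'w::ab_group_add \<Rightarrow> 'w) \<Rightarrow> polar_type \<Rightarrow> nat \<Rightarrow> ('f, 'w) form \<Rightarrow> bool" where
  "polar_form scale T n \<phi> \<longleftrightarrow>
     (\<exists>Basis. finite_dimensional_vector_space scale Basis) \<and>
     form_of_type scale T n \<phi> \<and> witt_index scale \<phi> = n"

text \<open>The maximum in the definition of the Witt index exists:\<close>

lemma witt_index_iff:
  assumes fd: "finite_dimensional_vector_space scale Basis" and \<phi>: "form_of_type scale T m \<phi>"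
  shows "witt_index scale \<phi> = n \<longleftrightarrow>
    isotropic_spaces scale \<phi> n \<noteq> {} \<and> (\<forall>i. isotropic_spaces scale \<phi> i \<noteq> {} \<longrightarrow> i \<le> n)"
proof -
  interpret finite_dimensional_vector_space scale Basis by fact
  have "totally_isotropic \<phi> {0}"
  proof -
    have "q 0 = 0" if "quadratic_form scale q" for q
    proof -
      have "q (scale 0 0) = 0\<^sup>2 * q 0"
        using that unfolding quadratic_form_def by blast
      then show ?thesis by simp
    qed
    moreover have "f 0 0 = 0" if "sesquilinear scale \<sigma> f" for \<sigma> f
    proof -
      have "f (scale 0 0) 0 = 0 * f 0 0"
        using that unfolding sesquilinear_def by blast
      then show ?thesis by simp
    qed
    moreover have "(\<exists>q. \<phi> = Quadratic q \<and> quadratic_form scale q) \<or>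
                   (\<exists>\<sigma> f. \<phi> = Sesquilinear f \<and> sesquilinear scale \<sigma> f)"
      using \<phi> by (cases T) (auto simp: alternating_form_def hermitian_form_def)
    ultimately have "(\<exists>q. \<phi> = Quadratic q \<and> q 0 = 0) \<or> (\<exists>f. \<phi> = Sesquilinear f \<and> f 0 0 = 0)"
      by blast
    then show ?thesis by (elim disjE exE conjE) simp_all
  qed
  then have ne: "{i. isotropic_spaces scale \<phi> i \<noteq> {}} \<noteq> {}"
    using subspace_single_0 unfolding isotropic_spaces_def by blast
  have "{i. isotropic_spaces scale \<phi> i \<noteq> {}} \<subseteq> {..dimension}"
    using dim_subset_UNIV by (auto simp: isotropic_spaces_def)
  then have "finite {i. isotropic_spaces scale \<phi> i \<noteq> {}}"
    by (rule finite_subset) simp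
  with ne show ?thesis
    unfolding witt_index_def by (subst Max_eq_iff) auto
qed

section \<open>The polar building and its Grassmannians\<close>

definition building_objects ::
  "('f::field \<Rightarrow> 'w::ab_group_add \<Rightarrow> 'w) \<Rightarrow> ('f, 'w) form \<Rightarrow> nat \<Rightarrow> 'w set set" where
  "building_objects scale \<phi> n = (\<Union>i\<in>{1..n}. isotropic_spaces scale \<phi> i)"

definition incident :: "'w set \<Rightarrow> 'w set \<Rightarrow> bool" where
  "incident U V \<longleftrightarrow> U \<subseteq> V \<or> V \<subseteq> U"

definition building_auts ::
  "('f::field \<Rightarrow> 'w::ab_group_add \<Rightarrow> 'w) \<Rightarrow> ('f, 'w) form \<Rightarrow> nat \<Rightarrow> ('w set \<Rightarrow> 'w set) set" where
  "building_auts scale \<phi> n =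
     {g \<in> Bij (building_objects scale \<phi> n).
        (\<forall>U\<in>building_objects scale \<phi> n. vector_space.dim scale (g U) = vector_space.dim scale U) \<and>
        (\<forall>U\<in>building_objects scale \<phi> n. \<forall>V\<in>building_objects scale \<phi> n.
           incident (g U) (g V) \<longleftrightarrow> incident U V)}"

definition Aut_building ::
  "('f::field \<Rightarrow> 'w::ab_group_add \<Rightarrow> 'w) \<Rightarrow> ('f, 'w) form \<Rightarrow> nat \<Rightarrow> ('w set \<Rightarrow> 'w set) monoid" where
  "Aut_building scale \<phi> n =
     BijGroup (building_objects scale \<phi> n) \<lparr>carrier := building_auts scale \<phi> n\<rparr>"

definition grassmannian_lines ::
  "('f::field \<Rightarrow> 'w::ab_group_add \<Rightarrow> 'w) \<Rightarrow> ('f, 'w) form \<Rightarrow> nat \<Rightarrow> nat \<Rightarrow> 'w set set set" where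
  "grassmannian_lines scale \<phi> n k =
     (if k < n
      then {{B \<in> isotropic_spaces scale \<phi> k. A \<subseteq> B \<and> B \<subseteq> C} | A C.
              A \<in> isotropic_spaces scale \<phi> (k - 1) \<and> C \<in> isotropic_spaces scale \<phi> (k + 1) \<and> A \<subseteq> C}
      else {{B \<in> isotropic_spaces scale \<phi> k. A \<subseteq> B} | A. A \<in> isotropic_spaces scale \<phi> (k - 1)})"

definition geometry_auts :: "'p set \<Rightarrow> 'p set set \<Rightarrow> ('p \<Rightarrow> 'p) set" where
  "geometry_auts points lines = {g \<in> Bij points. bij_betw (\<lambda>L. g ` L) lines lines}"

definition Aut_grassmannian ::
  "('f::field \<Rightarrow> 'w::ab_group_add \<Rightarrow> 'w) \<Rightarrow> ('f, 'w) form \<Rightarrow> nat \<Rightarrow> nat \<Rightarrow>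
     ('w set \<Rightarrow> 'w set) monoid" where
  "Aut_grassmannian scale \<phi> n k =
     BijGroup (isotropic_spaces scale \<phi> k)
       \<lparr>carrier := geometry_auts (isotropic_spaces scale \<phi> k) (grassmannian_lines scale \<phi> n k)\<rparr>"

lemma group_BijGroup_sub:
  assumes sub: "H \<subseteq> Bij S" and one: "(\<lambda>x\<in>S. x) \<in> H"
    and comp: "\<And>g h. g \<in> H \<Longrightarrow> h \<in> H \<Longrightarrow> compose S g h \<in> H"
    and inv: "\<And>g. g \<in> H \<Longrightarrow> restrict (inv_into S g) S \<in> H"
  shows "group (BijGroup S \<lparr>carrier := H\<rparr>)"
proof (rule subgroup.subgroup_is_group[OF _ group_BijGroup])
  show "subgroup H (BijGroup S)"
  proof (rule subgroup.intro)
    show "H \<subseteq> carrier (BijGroup S)" using sub by (simp add: BijGroup_def)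
    show "\<one>\<^bsub>BijGroup S\<^esub> \<in> H" using one by (simp add: BijGroup_def)
    show "g \<otimes>\<^bsub>BijGroup S\<^esub> h \<in> H" if "g \<in> H" "h \<in> H" for g h
      using that sub comp by (auto simp: BijGroup_def subset_iff)
    show "inv\<^bsub>BijGroup S\<^esub> g \<in> H" if "g \<in> H" for g
      using that sub inv inv_BijGroup by (metis subsetD)
  qed
qed

lemma group_Aut_building: "group (Aut_building scale \<phi> n)"
  unfolding Aut_building_def
proof (rule group_BijGroup_sub)
  let ?S = "building_objects scale \<phi> n"
  show "building_auts scale \<phi> n \<subseteq> Bij ?S" by (auto simp: building_auts_def)
  show "(\<lambda>x\<in>?S. x) \<in> building_auts scale \<phi> n" by (auto simp: building_auts_def id_Bij)
  show "compose ?S g h \<in> building_auts scale \<phi> n"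
    if "g \<in> building_auts scale \<phi> n" "h \<in> building_auts scale \<phi> n" for g h
  proof -
    have "h U \<in> ?S" if "U \<in> ?S" for U
      using \<open>h \<in> _\<close> that by (auto simp: building_auts_def dest!: Bij_imp_funcset)
    then show ?thesis using that
      by (simp add: building_auts_def compose_Bij compose_eq)
  qed
  show "restrict (inv_into ?S g) ?S \<in> building_auts scale \<phi> n"
    if g: "g \<in> building_auts scale \<phi> n" for g
  proof -
    have b: "g \<in> Bij ?S" using g by (simp add: building_auts_def)
    have 1: "inv_into ?S g U \<in> ?S" if "U \<in> ?S" for U
      using b that by (rule Bij_inv_into_mem)
    have 2: "g (inv_into ?S g U) = U" if "U \<in> ?S" for U
      using b that by (auto simp: Bij_def bij_betw_def f_inv_into_f)
    have "vector_space.dim scale (inv_into ?S g U) = vector_space.dim scale U" if "U \<in> ?S" for U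
      using g 1[OF that] 2[OF that] by (force simp: building_auts_def)
    moreover have "incident (inv_into ?S g U) (inv_into ?S g V) \<longleftrightarrow> incident U V"
      if "U \<in> ?S" "V \<in> ?S" for U V
    proof -
      have "incident (g (inv_into ?S g U)) (g (inv_into ?S g V)) \<longleftrightarrow>
            incident (inv_into ?S g U) (inv_into ?S g V)"
        using g 1[OF that(1)] 1[OF that(2)] by (simp add: building_auts_def)
      then show ?thesis using 2[OF that(1)] 2[OF that(2)] by simp
    qed
    ultimately show ?thesis
      by (simp add: building_auts_def restrict_inv_into_Bij b)
  qed
qed

lemma group_Aut_grassmannian:
  fixes scale :: "'f::field \<Rightarrow> 'w::ab_group_add \<Rightarrow> 'w"
  shows "group (Aut_grassmannian scale \<phi> n k)"
  unfolding Aut_grassmannian_def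
proof (rule group_BijGroup_sub)
  let ?S = "isotropic_spaces scale \<phi> k"
  let ?L = "grassmannian_lines scale \<phi> n k"
  have LS: "L \<subseteq> ?S" if "L \<in> ?L" for L
    using that by (auto simp: grassmannian_lines_def split: if_splits)
  show "geometry_auts ?S ?L \<subseteq> Bij ?S" by (auto simp: geometry_auts_def)
  have id_lines: "bij_betw (\<lambda>L. (\<lambda>x\<in>?S. x) ` L) ?L ?L \<longleftrightarrow> bij_betw id ?L ?L"
    using LS by (intro bij_betw_cong) (force simp: subset_iff)
  show "(\<lambda>x\<in>?S. x) \<in> geometry_auts ?S ?L"
    unfolding geometry_auts_def mem_Collect_eq id_lines by (simp only: id_Bij bij_betw_id simp_thms)
  show "compose ?S g h \<in> geometry_auts ?S ?L"
    if "g \<in> geometry_auts ?S ?L" "h \<in> geometry_auts ?S ?L" for g h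
  proof -
    have "bij_betw ((\<lambda>L. g ` L) \<circ> (\<lambda>L. h ` L)) ?L ?L"
      using that unfolding geometry_auts_def by (blast intro: bij_betw_trans)
    moreover have comp_eq: "compose ?S g h ` L = ((\<lambda>L. g ` L) \<circ> (\<lambda>L. h ` L)) L" if "L \<in> ?L" for L
      using LS[OF that] unfolding comp_def image_image by (intro image_cong) (auto simp: compose_def)
    ultimately have "bij_betw (\<lambda>L. compose ?S g h ` L) ?L ?L"
      by (subst bij_betw_cong[OF comp_eq])
    then show ?thesis using that by (simp add: geometry_auts_def compose_Bij)
  qed
  show "restrict (inv_into ?S g) ?S \<in> geometry_auts ?S ?L"
    if g: "g \<in> geometry_auts ?S ?L" for g
  proof -
    have b: "g \<in> Bij ?S" and bl: "bij_betw (\<lambda>L. g ` L) ?L ?L"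
      using g by (auto simp: geometry_auts_def)
    have inj: "inj_on g ?S" using b by (simp add: Bij_def bij_betw_def)
    have inv_eq: "restrict (inv_into ?S g) ?S ` L = inv_into ?L (\<lambda>L. g ` L) L" if L: "L \<in> ?L" for L
    proof -
      obtain M where M: "M \<in> ?L" "L = g ` M"
        using bl L unfolding bij_betw_def by blast
      have "restrict (inv_into ?S g) ?S ` L = inv_into ?S g ` L"
        using LS[OF L] by (intro image_cong) auto
      also have "\<dots> = M" using inj LS M by (simp add: inv_into_image_cancel)
      also have "\<dots> = inv_into ?L (\<lambda>L. g ` L) L"
        using bl M by (simp add: bij_betw_def inv_into_f_f)
      finally show ?thesis .
    qed
    have "bij_betw (\<lambda>L. restrict (inv_into ?S g) ?S ` L) ?L ?L"
      using bij_betw_inv_into[OF bl] by (subst bij_betw_cong[OF inv_eq])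
    with restrict_inv_into_Bij[OF b] show ?thesis
      unfolding geometry_auts_def by blast
  qed
qed

end

theory Submission
  imports Defs
begin

text \<open>
  Only collinearity of \<open>\<Gamma>\<close> is needed. Call totally isotropic \<open>k\<close>-spaces \<open>B\<close>, \<open>C\<close> hyperbolic if
  \<open>B \<inter> C\<close> has dimension \<open>k - 1\<close> and \<open>B\<close> is not orthogonal to \<open>C\<close>. For \<open>k = n\<close> this is collinearity;
  for \<open>k < n\<close> it is recognised inside the common neighbourhood of \<open>B\<close> and \<open>C\<close>, which is a thick polar
  space of rank \<open>n - k\<close> for a hyperbolic pair, and a grid or at most one point for the other
  non-collinear pairs. Thickness (every totally isotropic \<open>(n - 1)\<close>-space lies on at least three
  maximal ones) is what separates a polar space of rank 2 from a grid, and the only place where the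
  type of the form enters. The totally isotropic \<open>k\<close>-spaces containing \<open>B \<inter> C\<close> are then those that
  are equal to or meet in codimension 1 both \<open>B\<close> and \<open>C\<close>. Hence an automorphism of \<open>\<Gamma>\<close> induces one of
  the \<open>(k - 1)\<close>-Grassmannian compatible with inclusion and, by descent, a permutation of the isotropic
  points preserving orthogonality. The maximal cliques of the points are the maximal totally
  isotropic spaces, and every totally isotropic space is an intersection of those, so the
  permutation extends to the building.
\<close>

section \<open>Dimension formulas\<close>

text \<open>Having common neighbours does not distinguish a hyperbolic pair from two orthogonal
  spaces meeting in codimension 2. The test in \<open>hyp_iff\<close> asks for three pairwise
  non-adjacent common neighbours and a further one adjacent to all three. In a grid every point lies
  on just two lines, so two of the three would share a line; in a thick polar space of rank at least
  2 they come from three maximal subspaces on a submaximal one. For \<open>k = n - 1\<close> the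
  fourth space is not asked for: the neighbourhood then has rank 1, and the competing grid would
  need a totally isotropic space of dimension \<open>k + 2 > n\<close>.

  The third maximal space has a different source for each kind of form: a plain sum of two vectors
  for alternating forms, a non-zero element of trace zero for hermitian forms, and a non-singular
  vector orthogonal to a hyperbolic pair for quadratic forms.\<close>

context finite_dimensional_vector_space
begin

lemma dim_insert_subspace:
  assumes "subspace U" "x \<notin> U"
  shows "dim (insert x U) = Suc (dim U)"
  using assms by (simp add: dim_insert span_eq_iff[THEN iffD2])

lemma dim_span_Un:
  assumes "subspace U" "subspace V"
  shows "dim (span (U \<union> V)) + dim (U \<inter> V) = dim U + dim V"
proof -
  have "span (U \<union> V) = {x + y |x y. x \<in> U \<and> y \<in> V}"
    using assms by (simp add: span_Un span_eq_iff[THEN iffD2])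
  then show ?thesis using dim_sums_Int[OF assms] by simp
qed

lemma subspace_eqI:
  assumes "subspace U" "subspace V" "U \<subseteq> V" "dim V \<le> dim U"
  shows "U = V"
  using subspace_dim_equal[OF assms(1-3)] assms(4) by simp

lemma dim_Int_less:
  assumes "subspace U" "subspace V" "dim U = dim V" "U \<noteq> V"
  shows "dim (U \<inter> V) < dim U"
proof (rule ccontr)
  assume "\<not> dim (U \<inter> V) < dim U"
  then have "U \<inter> V = U" "U \<inter> V = V"
    using assms subspace_inter[of U V]
    by (intro subspace_eqI[of "U \<inter> V"]; simp)+
  then show False using \<open>U \<noteq> V\<close> by blast
qed

lemma subspace_insert_eq:
  assumes "subspace A" "subspace B" "A \<subseteq> B" "dim B = Suc (dim A)" "e \<in> B" "e \<notin> A"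
  shows "span (insert e A) = B"
proof (rule subspace_eqI)
  show "span (insert e A) \<subseteq> B" using assms by (intro span_minimal) auto
qed (use assms in \<open>simp_all add: dim_insert_subspace\<close>)

lemma subspace_between:
  assumes "subspace U" "subspace V" "U \<subseteq> V" "dim U \<le> j" "j \<le> dim V"
  obtains W where "subspace W" "U \<subseteq> W" "W \<subseteq> V" "dim W = j"
proof -
  have "\<exists>W. subspace W \<and> U \<subseteq> W \<and> W \<subseteq> V \<and> dim W = j"
    using assms(4,5)
  proof (induction j rule: dec_induct)
    case base
    then show ?case using assms by blast
  next
    case (step j)
    then obtain W where W: "subspace W" "U \<subseteq> W" "W \<subseteq> V" "dim W = j" by auto
    then have "W \<noteq> V" using step by auto
    then obtain x where "x \<in> V" "x \<notin> W" using W by blast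
    then have "span (insert x W) \<subseteq> V" using W assms by (intro span_minimal) auto
    moreover have "U \<subseteq> span (insert x W)" using W span_superset by blast
    moreover have "dim (span (insert x W)) = Suc j" using W \<open>x \<notin> W\<close> by (simp add: dim_insert_subspace)
    ultimately show ?case by blast
  qed
  then show ?thesis using that by blast
qed

end

section \<open>Abstract polar spaces\<close>

text \<open>Only the orthogonality relation is kept, not the form, so that quadratic, alternating
  and hermitian forms share one development. \<open>orth_hyperplane\<close> stands in for the linear
  functional: the vectors orthogonal to \<open>x\<close> form a hyperplane or everything.
  Singularity is separate from self-orthogonality because in characteristic 2 the bilinear form of a
  quadratic form makes every vector orthogonal to itself.\<close>

locale orthogonality = finite_dimensional_vector_space scale Basis
  for scale :: "'f::field \<Rightarrow> 'w::ab_group_add \<Rightarrow> 'w" and Basis :: "'w set" +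
  fixes orth :: "'w \<Rightarrow> 'w \<Rightarrow> bool" and sing :: "'w \<Rightarrow> bool"
  assumes orth_sym: "orth x y \<Longrightarrow> orth y x"
    and subspace_orth: "subspace {y. orth x y}"
    and orth_hyperplane: "\<not> orth x y \<Longrightarrow> \<exists>c. orth x (z - scale c y)"
    and sing_0: "sing 0"
    and sing_scale: "sing x \<Longrightarrow> sing (scale c x)"
    and sing_add: "sing x \<Longrightarrow> sing y \<Longrightarrow> orth x y \<Longrightarrow> sing (x + y)"
    and sing_orth: "sing x \<Longrightarrow> orth x x"
begin

section \<open>Calculus of totally isotropic subspaces\<close>

definition perp :: "'w set \<Rightarrow> 'w set \<Rightarrow> bool" where
  "perp U V \<longleftrightarrow> (\<forall>x\<in>U. \<forall>y\<in>V. orth x y)"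

definition ti :: "'w set \<Rightarrow> bool" where
  "ti U \<longleftrightarrow> subspace U \<and> (\<forall>x\<in>U. sing x) \<and> perp U U"

definition TI :: "nat \<Rightarrow> 'w set set" where
  "TI k = {U. ti U \<and> dim U = k}"

lemma TI_D: 
  assumes "U \<in> TI k" 
  shows "ti U" "subspace U" "dim U = k" "0 \<in> U"
  using assms by (auto simp: TI_def ti_def subspace_0)

lemma orth_add: "orth x y \<Longrightarrow> orth x z \<Longrightarrow> orth x (y + z)"
  and orth_diff: "orth x y \<Longrightarrow> orth x z \<Longrightarrow> orth x (y - z)"
  and orth_scale: "orth x y \<Longrightarrow> orth x (scale c y)"
  and orth_0: "orth x 0"
  using subspace_add[OF subspace_orth[of x]] subspace_diff[OF subspace_orth[of x]]
    subspace_scale[OF subspace_orth[of x]] subspace_0[OF subspace_orth[of x]] by auto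

lemma orth_span: "(\<And>y. y \<in> S \<Longrightarrow> orth x y) \<Longrightarrow> y \<in> span S \<Longrightarrow> orth x y"
  using span_minimal[OF _ subspace_orth, of S x] by auto

lemma orth_span2:
  assumes "\<And>x y. x \<in> S \<Longrightarrow> y \<in> R \<Longrightarrow> orth x y" "x \<in> span S" "y \<in> span R"
  shows "orth x y"
proof -
  have "orth y x'" if "x' \<in> S" for x'
    using orth_span[of R x' y] assms that orth_sym by auto
  then show ?thesis using orth_span[of S y x] assms(2) orth_sym by auto
qed

lemma perp_sym: "perp U V \<Longrightarrow> perp V U"
  unfolding perp_def using orth_sym by blast

lemma perp_mono: "perp U V \<Longrightarrow> U' \<subseteq> U \<Longrightarrow> V' \<subseteq> V \<Longrightarrow> perp U' V'"
  by (auto simp: perp_def)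

lemma perp_span: "perp U V \<Longrightarrow> perp (span U) (span V)"
  unfolding perp_def using orth_span2[of U V] by blast

lemma ti_perp: "ti C \<Longrightarrow> U \<subseteq> C \<Longrightarrow> V \<subseteq> C \<Longrightarrow> perp U V"
  unfolding ti_def perp_def by blast

lemma ti_subset: "ti U \<Longrightarrow> subspace V \<Longrightarrow> V \<subseteq> U \<Longrightarrow> ti V"
  unfolding ti_def perp_def by blast

lemma ti_Int: "ti U \<Longrightarrow> subspace V \<Longrightarrow> ti (U \<inter> V)"
  by (rule ti_subset[of U]) (auto simp: ti_def intro: subspace_inter)

lemma ti_0: "ti {0}"
  by (auto simp: ti_def perp_def sing_0 orth_0)

lemma ti_span_singletons:
  assumes sing: "\<And>x. x \<in> S \<Longrightarrow> sing x" and perp: "perp S S"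
  shows "ti (span S)"
proof -
  have *: "perp (span S) (span S)" using perp_span[OF perp] .
  \<comment> \<open>Membership is carried through the induction because a sum of singular vectors is
    singular only if the summands are orthogonal, which here follows from both lying in
    \<open>span S\<close>.\<close>
  have "sing x \<and> x \<in> span S" if "x \<in> span S" for x
    using that
  proof (induction rule: span_induct_alt)
    case (step c x y)
    then have "orth (scale c x) y" "scale c x \<in> span S"
      using * by (auto simp: perp_def span_base span_scale)
    then show ?case using step sing by (auto intro: sing_add sing_scale span_add)
  qed (simp add: sing_0 span_zero)
  then show ?thesis using * by (auto simp: ti_def)
qed

lemma ti_Un: "ti U \<Longrightarrow> ti V \<Longrightarrow> perp U V \<Longrightarrow> ti (span (U \<union> V))"
  using perp_sym[of U V] by (intro ti_span_singletons) (auto simp: ti_def perp_def)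

lemma ti_insert:
  assumes "ti U" "sing x" "perp U {x}"
  shows "ti (span (insert x U))"
proof (rule ti_span_singletons)
  show "perp (insert x U) (insert x U)"
    using assms perp_sym[OF assms(3)] sing_orth[of x] unfolding ti_def perp_def by blast
qed (use assms in \<open>auto simp: ti_def\<close>)

lemma TI_insert:
  assumes "U \<in> TI k" "sing x" "perp U {x}" "x \<notin> U"
  shows "span (insert x U) \<in> TI (Suc k)"
proof -
  have "dim (insert x U) = Suc k"
    using assms TI_D[OF assms(1)] by (subst dim_insert_subspace) auto
  moreover have "ti (span (insert x U))"
    using assms by (intro ti_insert TI_D)
  ultimately show ?thesis by (simp add: TI_def)
qed

lemma subspace_perp: "subspace {y. \<forall>x\<in>A. orth x y}"
  by (rule subspaceI) (auto simp: orth_0 orth_add orth_scale)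

lemma dim_Int_orth: 
  assumes "subspace S"
  shows "dim S \<le> Suc (dim (S \<inter> {y. orth x y}))"
proof (cases "S \<subseteq> {y. orth x y}")
  case True
  then show ?thesis by (simp add: Int_absorb2)
next
  case False
  then obtain y where y: "y \<in> S" "\<not> orth x y" by auto
  have "S \<subseteq> span (insert y (S \<inter> {y. orth x y}))"
  proof
    fix z assume "z \<in> S"
    obtain c where "orth x (z - scale c y)" using orth_hyperplane[OF y(2)] by blast
    moreover have "z - scale c y \<in> S" using assms \<open>z \<in> S\<close> y by (simp add: subspace_diff subspace_scale)
    ultimately have "z - scale c y \<in> span (S \<inter> {y. orth x y})" by (simp add: span_base)
    then show "z \<in> span (insert y (S \<inter> {y. orth x y}))" by (auto simp: span_breakdown_eq)
  qed
  then have "dim S \<le> dim (span (insert y (S \<inter> {y. orth x y})))"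
    by (simp add: dim_mono)
  also have "\<dots> = Suc (dim (S \<inter> {y. orth x y}))"
    using y assms subspace_inter subspace_orth by (simp add: dim_insert_subspace)
  finally show ?thesis .
qed

text \<open>The conditions imposed by \<open>A\<close> reduce to those of a maximal independent
  subset, each of which costs at most one dimension by \<open>dim_Int_orth\<close>.\<close>

lemma dim_Int_perp:
  assumes "subspace S"
  shows "dim S \<le> dim (S \<inter> {y. \<forall>x\<in>A. orth x y}) + dim A"
proof -
  obtain X where X: "X \<subseteq> A" "independent X" "A \<subseteq> span X" "card X = dim A"
    using basis_exists by blast
  have "dim S \<le> dim (S \<inter> {y. \<forall>x\<in>X. orth x y}) + card X"
    using finiteI_independent[OF X(2)]
  proof (induction X rule: finite_induct)
    case (insert x X)
    have "dim (S \<inter> {y. \<forall>x\<in>X. orth x y}) \<le> Suc (dim (S \<inter> {y. \<forall>x\<in>X. orth x y} \<inter> {y. orth x y}))"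
      by (intro dim_Int_orth subspace_inter assms subspace_perp)
    also have "S \<inter> {y. \<forall>x\<in>X. orth x y} \<inter> {y. orth x y} = S \<inter> {y. \<forall>x\<in>insert x X. orth x y}"
      by auto
    finally show ?case using insert by simp
  qed simp
  moreover have "(\<forall>x\<in>X. orth x y) \<longleftrightarrow> (\<forall>x\<in>A. orth x y)" for y
    using X(1,3) orth_sym[of _ y] orth_sym[of y] orth_span[of X y] by blast
  ultimately show ?thesis using X by simp
qed

lemma orth_hyperplane_eq:
  assumes "subspace S" "y \<in> S" "\<not> orth x y"
  shows "dim S = Suc (dim (S \<inter> {y. orth x y}))"
proof -
  have "dim (S \<inter> {y. orth x y}) < dim S"
    using assms by (intro dim_psubset) (auto simp: span_eq_iff[THEN iffD2] subspace_inter subspace_orth)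
  then show ?thesis using dim_Int_orth[OF assms(1), of x] by simp
qed

end

text \<open>The first two assumptions make \<open>n\<close> the Witt index. \<open>thick\<close> is
  phrased with vectors: \<open>e\<close> and \<open>f\<close> give two different maximal spaces on
  \<open>A\<close>, and \<open>g\<close> gives a third. Non-degeneracy asks for a singular witness
  because it is fed into \<open>projection\<close>.\<close>

locale polar_space = orthogonality scale Basis orth sing
  for scale :: "'f::field \<Rightarrow> 'w::ab_group_add \<Rightarrow> 'w" and Basis orth sing +
  fixes n :: nat
  assumes TI_n: "TI n \<noteq> {}"
    and TI_le: "TI i \<noteq> {} \<Longrightarrow> i \<le> n"
    and nondeg: "sing x \<Longrightarrow> x \<noteq> 0 \<Longrightarrow> \<exists>y. sing y \<and> \<not> orth x y"
    and thick: "A \<in> TI (n - 1) \<Longrightarrow> sing e \<Longrightarrow> sing f \<Longrightarrow> perp A {e, f} \<Longrightarrow> \<not> orth e f \<Longrightarrow>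
      \<exists>g. sing g \<and> perp A {g} \<and> \<not> orth e g \<and> \<not> orth f g"
begin

section \<open>Maximal totally isotropic subspaces\<close>

lemma ti_dim_le: "ti U \<Longrightarrow> dim U \<le> n"
  using TI_le[of "dim U"] by (auto simp: TI_def)

lemma maximal_ti:
  assumes "M \<in> TI n" "ti U" "M \<subseteq> U"
  shows "U = M"
  using assms ti_dim_le[of U] TI_D[OF assms(1)] by (metis subspace_eqI ti_def)

lemma maximal_not_perp:
  assumes "M \<in> TI n" "M' \<in> TI n" "M \<noteq> M'"
  shows "\<not> perp M M'"
proof
  assume "perp M M'"
  then have *: "ti (span (M \<union> M'))" using assms by (intro ti_Un TI_D)
  have "span (M \<union> M') = M" "span (M \<union> M') = M'"
    by (rule maximal_ti[OF assms(1) *] maximal_ti[OF assms(2) *]; use span_superset in blast)+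
  then show False using \<open>M \<noteq> M'\<close> by simp
qed

lemma maximal_mem:
  assumes "M \<in> TI n" "sing x" "perp M {x}"
  shows "x \<in> M"
  using maximal_ti[OF assms(1) ti_insert[OF TI_D(1)[OF assms(1)] assms(2,3)]] span_superset by blast

text \<open>The basic exchange: by maximality \<open>x\<close> is not orthogonal to all of
  \<open>M\<close>, so passing to the orthogonal part loses exactly one dimension, which adding
  \<open>x\<close> restores. It serves both to enlarge intersections (\<open>extend_maximal\<close>)
  and to shrink them (\<open>opposite_maximal\<close>).\<close>

lemma projection:
  assumes M: "M \<in> TI n" and x: "sing x" "x \<notin> M"
  defines "N \<equiv> span (insert x (M \<inter> {y. orth x y}))"
  shows "N \<in> TI n" "x \<in> N" "M \<inter> {y. orth x y} \<subseteq> N" "M \<inter> N \<subseteq> {y. orth x y}"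
proof -
  let ?H = "M \<inter> {y. orth x y}"
  have H: "ti ?H" using ti_Int[OF TI_D(1)[OF M] subspace_orth] .
  have "\<not> perp M {x}" using maximal_mem[OF M x(1)] x(2) by blast
  then obtain y where "y \<in> M" "\<not> orth x y" by (auto simp: perp_def dest: orth_sym)
  then have "n = Suc (dim ?H)" using orth_hyperplane_eq[of M y x] TI_D[OF M] by simp
  moreover have "?H \<in> TI (dim ?H)" using H by (simp add: TI_def)
  moreover have "perp ?H {x}" using orth_sym by (auto simp: perp_def)
  ultimately show N: "N \<in> TI n" using TI_insert[of ?H "dim ?H" x] x by (simp add: N_def)
  show "x \<in> N" unfolding N_def by (simp add: span_base)
  show "?H \<subseteq> N" unfolding N_def by (auto intro: span_base)
  show "M \<inter> N \<subseteq> {y. orth x y}"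
    using TI_D(1)[OF N] \<open>x \<in> N\<close> by (auto simp: ti_def perp_def)
qed

text \<open>Enlarging \<open>U\<close> step by step would only reach a space maximal under
  inclusion. To reach dimension \<open>n\<close>, one starts from an \<open>n\<close>-dimensional
  \<open>M\<close> meeting \<open>U\<close> as much as possible. If some \<open>u\<close> in
  \<open>U\<close> were outside \<open>M\<close>, projecting would keep \<open>M \<inter> U\<close>,
  which is orthogonal to \<open>u\<close>, and gain \<open>u\<close>.\<close>

lemma extend_maximal:
  assumes "ti U"
  obtains M where "M \<in> TI n" "U \<subseteq> M"
proof -
  obtain M where M: "M \<in> TI n" and max: "\<And>N. N \<in> TI n \<Longrightarrow> dim (N \<inter> U) \<le> dim (M \<inter> U)"
  proof -
    define R where "R = (\<lambda>N. dim (N \<inter> U)) ` TI n"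
    have "R \<subseteq> {..dimension}" using dim_subset_UNIV by (auto simp: R_def)
    then have "finite R" by (rule finite_subset) simp
    moreover have "R \<noteq> {}" using TI_n by (simp add: R_def)
    ultimately have "Max R \<in> R" "\<And>r. r \<in> R \<Longrightarrow> r \<le> Max R" by auto
    then show ?thesis using that unfolding R_def by fastforce
  qed
  have "U \<subseteq> M"
  proof
    fix u assume u: "u \<in> U"
    show "u \<in> M"
    proof (rule ccontr)
      assume "u \<notin> M"
      have su: "sing u" using u assms by (simp add: ti_def)
      define N where "N = span (insert u (M \<inter> {y. orth u y}))"
      note N = projection[OF M su \<open>u \<notin> M\<close>, folded N_def]
      have "M \<inter> U \<subseteq> M \<inter> {y. orth u y}" using assms u by (auto simp: ti_def perp_def)
      then have "M \<inter> U \<subseteq> N \<inter> U" using N(3) by blast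
      moreover have "u \<in> N \<inter> U" "u \<notin> M \<inter> U" using u N \<open>u \<notin> M\<close> by auto
      ultimately have "M \<inter> U \<subset> N \<inter> U" by auto
      then have "dim (M \<inter> U) < dim (N \<inter> U)"
        using M N assms by (intro dim_psubset) (simp add: span_eq_iff[THEN iffD2] subspace_inter TI_D ti_def)
      then show False using max[OF N(1)] by simp
    qed
  qed
  with M that show ?thesis by blast
qed

lemma opposite_maximal:
  assumes M: "M \<in> TI n"
  obtains N where "N \<in> TI n" "M \<inter> N = {0}"
proof -
  obtain N where N: "N \<in> TI n" and min: "\<And>N'. N' \<in> TI n \<Longrightarrow> dim (M \<inter> N) \<le> dim (M \<inter> N')"
    using TI_n arg_min_nat_lemma[of "\<lambda>N. N \<in> TI n" _ "\<lambda>N. dim (M \<inter> N)"] by blast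
  have "M \<inter> N \<subseteq> {0}"
  proof
    fix p assume p: "p \<in> M \<inter> N"
    show "p \<in> {0}"
    proof (rule ccontr)
      assume "p \<notin> {0}"
      moreover have "sing p" using p TI_D(1)[OF M] by (simp add: ti_def)
      ultimately obtain y where y: "sing y" "\<not> orth p y" using nondeg[of p] by auto
      have "y \<notin> N" using p y TI_D(1)[OF N] by (auto simp: ti_def perp_def)
      define N' where "N' = span (insert y (N \<inter> {z. orth y z}))"
      note N' = projection[OF N y(1) \<open>y \<notin> N\<close>, folded N'_def]
      \<comment> \<open>A vector \<open>z\<close> of the new intersection is a multiple
        \<open>c\<close> of \<open>y\<close> plus a vector of \<open>N\<close> orthogonal to
        \<open>y\<close>. As \<open>p\<close> is orthogonal to \<open>z\<close> and to all of
        \<open>N\<close> but not to \<open>y\<close>, \<open>c = 0\<close>. So nothing new enters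
        the intersection, while \<open>p\<close> drops out.\<close>
      have "M \<inter> N' \<subseteq> N \<inter> {z. orth y z}"
      proof
        fix z assume z: "z \<in> M \<inter> N'"
        then obtain c where c: "z - scale c y \<in> N \<inter> {z. orth y z}"
          using subspace_inter[OF TI_D(2)[OF N] subspace_orth, of y]
          by (auto simp: N'_def span_breakdown_eq span_eq_iff[THEN iffD2])
        then have "orth p (z - scale c y)" "orth p z"
          using p z TI_D(1)[OF N] TI_D(1)[OF M] unfolding ti_def perp_def by auto
        then have *: "orth p (scale c y)" using orth_diff[of p z "z - scale c y"] by simp
        have "c = 0"
        proof (rule ccontr)
          assume "c \<noteq> 0"
          then have "orth p y" using orth_scale[OF *, of "inverse c"] by simp
          then show False using y by simp
        qed
        then show "z \<in> N \<inter> {z. orth y z}" using c by simp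
      qed
      moreover have "p \<notin> {z. orth y z}" using y orth_sym by blast
      ultimately have "M \<inter> N' \<subset> M \<inter> N" using p by blast
      then have "dim (M \<inter> N') < dim (M \<inter> N)"
        using M N N' by (intro dim_psubset) (simp add: span_eq_iff[THEN iffD2] subspace_inter TI_D)
      then show False using min[OF N'(1)] by simp
    qed
  qed
  then have "M \<inter> N = {0}" using TI_D(4)[OF M] TI_D(4)[OF N] by blast
  then show ?thesis using N that by blast
qed

lemma hyperbolic_pair:
  assumes A: "A \<in> TI i" "i < n"
  obtains e f where "sing e" "sing f" "perp A {e, f}" "\<not> orth e f"
proof -
  obtain M where M: "M \<in> TI n" "A \<subseteq> M" using extend_maximal[OF TI_D(1)[OF A(1)]] .
  obtain N where N: "N \<in> TI n" "M \<inter> N = {0}" using opposite_maximal[OF M(1)] .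
  \<comment> \<open>\<open>A\<close> imposes fewer than \<open>n\<close> conditions on the opposite
    space \<open>N\<close>, which leaves a non-zero \<open>f\<close>. It is not in \<open>M\<close>,
    so maximality of \<open>M\<close> supplies an \<open>e\<close> in \<open>M\<close> that is not
    orthogonal to \<open>f\<close>.\<close>
  have "dim N \<le> dim (N \<inter> {y. \<forall>x\<in>A. orth x y}) + dim A"
    using N by (intro dim_Int_perp TI_D)
  then have "dim (N \<inter> {y. \<forall>x\<in>A. orth x y}) \<noteq> 0"
    using A(2) TI_D(3)[OF A(1)] TI_D(3)[OF N(1)] by linarith
  then obtain f where f: "f \<in> N" "\<forall>x\<in>A. orth x f" "f \<noteq> 0" by (auto simp: dim_eq_0)
  have "f \<notin> M" "sing f" using f N TI_D(1)[OF N(1)] by (auto simp: ti_def)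
  then have "\<not> perp M {f}" using maximal_mem[OF M(1)] by blast
  then obtain e where e: "e \<in> M" "\<not> orth e f" by (auto simp: perp_def)
  have "perp A {e, f}" "sing e"
    using f e M TI_D(1)[OF M(1)] unfolding ti_def perp_def by auto
  then show ?thesis using that e \<open>sing f\<close> by blast
qed

lemma hyperbolic_triple:
  assumes "A \<in> TI (n - 1)" "n > 0"
  obtains e f g where "sing e" "sing f" "sing g" "perp A {e, f, g}"
    "\<not> orth e f" "\<not> orth e g" "\<not> orth f g"
proof -
  obtain e f where ef: "sing e" "sing f" "perp A {e, f}" "\<not> orth e f"
    using hyperbolic_pair[OF assms(1)] \<open>n > 0\<close> by auto
  then obtain g where "sing g \<and> perp A {g} \<and> \<not> orth e g \<and> \<not> orth f g"
    using thick[OF assms(1)] by blast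
  then show ?thesis using that[of e f g] ef by (auto simp: perp_def)
qed

lemma hyperbolic_not_mem:
  assumes "ti A" "perp A {e, f}" "\<not> orth e f"
  shows "e \<notin> A" "f \<notin> A"
  using assms orth_sym unfolding perp_def ti_def by blast+

text \<open>A hyperbolic pair over \<open>V\<close> yields two one-step extensions with intersection
  \<open>V\<close>, so one of them misses \<open>p\<close>. The lemma makes a totally isotropic
  space the intersection of the \<open>j\<close>-spaces above it.\<close>

lemma TI_avoiding:
  assumes "U \<in> TI i" "i \<le> j" "j \<le> n" "p \<notin> U"
  obtains V where "V \<in> TI j" "U \<subseteq> V" "p \<notin> V"
proof -
  have "\<exists>V\<in>TI j. U \<subseteq> V \<and> p \<notin> V"
    using assms(2,3)
  proof (induction j rule: dec_induct)
    case base
    then show ?case using assms by blast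
  next
    case (step j)
    then obtain V where V: "V \<in> TI j" "U \<subseteq> V" "p \<notin> V" by auto
    obtain e f where ef: "sing e" "sing f" "perp V {e, f}" "\<not> orth e f"
      using hyperbolic_pair[OF V(1)] step by auto
    note ti = TI_D(1)[OF V(1)] and sub = TI_D(2)[OF V(1)]
    have nm: "e \<notin> V" "f \<notin> V" using hyperbolic_not_mem[OF ti ef(3,4)] by auto
    have ex: "span (insert e V) \<in> TI (Suc j)" "span (insert f V) \<in> TI (Suc j)"
      using ef nm V by (auto intro!: TI_insert simp: perp_def)
    have "p \<notin> span (insert e V) \<or> p \<notin> span (insert f V)"
    proof (rule ccontr)
      assume "\<not> ?thesis"
      then obtain c d where cd: "p - scale c e \<in> V" "p - scale d f \<in> V"
        using sub by (auto simp: span_breakdown_eq span_eq_iff[THEN iffD2])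
      \<comment> \<open>Modulo \<open>V\<close>, the vector \<open>p\<close> is a multiple of
        \<open>e\<close> and also \<open>d\<close> times \<open>f\<close>; orthogonality to
        \<open>e\<close> forces \<open>d = 0\<close>, so \<open>p\<close> would lie in
        \<open>V\<close>.\<close>
      have ee: "orth e (p - scale c e)" "orth e (p - scale d f)" "orth e (scale c e)"
        using cd ef orth_sym sing_orth orth_scale unfolding perp_def by auto
      have "orth e p" using orth_add[OF ee(1) ee(3)] by simp
      then have "orth e (scale d f)" using orth_diff[OF _ ee(2), of p] by simp
      then have "d = 0" using orth_scale[of e "scale d f" "inverse d"] ef by (cases "d = 0") auto
      then show False using cd V by simp
    qed
    moreover have "U \<subseteq> span (insert x V)" for x using V span_superset by blast
    ultimately show ?case using ex by blast
  qed
  then show ?thesis using that by blast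
qed

lemma TI_subspace: "ti M \<Longrightarrow> subspace W \<Longrightarrow> W \<subseteq> M \<Longrightarrow> W \<in> TI (dim W)"
  by (simp add: TI_def ti_subset)

lemma TI_between:
  assumes "U \<in> TI i" "ti V" "U \<subseteq> V" "i \<le> j" "j \<le> dim V"
  obtains W where "W \<in> TI j" "U \<subseteq> W" "W \<subseteq> V"
proof -
  obtain W where "subspace W" "U \<subseteq> W" "W \<subseteq> V" "dim W = j"
    using subspace_between[of U V j] assms TI_D[OF assms(1)] by (auto simp: ti_def)
  then show ?thesis using that TI_subspace[OF assms(2), of W] by auto
qed

lemma TI_extend:
  assumes "U \<in> TI i" "i \<le> j" "j \<le> n"
  obtains W where "W \<in> TI j" "U \<subseteq> W"
proof -
  obtain M where M: "M \<in> TI n" "U \<subseteq> M" using extend_maximal[OF TI_D(1)[OF assms(1)]] .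
  have "j \<le> dim M" using assms(3) TI_D(3)[OF M(1)] by simp
  from TI_between[OF assms(1) TI_D(1)[OF M(1)] M(2) assms(2) this]
  show ?thesis using that by blast
qed

section \<open>Collinearity\<close>

text \<open>Collinearity of two different points of the Grassmannian, by
  \<open>adj_iff_line\<close>. Orthogonality says that \<open>B\<close> and \<open>C\<close> lie in
  a common totally isotropic \<open>(k + 1)\<close>-space; for \<open>k = n\<close> lines have no
  upper space and the condition is dropped.\<close>

definition adj :: "nat \<Rightarrow> 'w set \<Rightarrow> 'w set \<Rightarrow> bool" where
  "adj k B C \<longleftrightarrow> B \<in> TI k \<and> C \<in> TI k \<and> Suc (dim (B \<inter> C)) = k \<and> (k < n \<longrightarrow> perp B C)"

definition hyp :: "nat \<Rightarrow> 'w set \<Rightarrow> 'w set \<Rightarrow> bool" where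
  "hyp k B C \<longleftrightarrow> B \<in> TI k \<and> C \<in> TI k \<and> Suc (dim (B \<inter> C)) = k \<and> \<not> perp B C"

lemma adj_irrefl: "\<not> adj k B B"
  by (auto simp: adj_def TI_def)

lemma hyp_irrefl: "\<not> hyp k B B"
  by (auto simp: hyp_def TI_def)

lemma hyp_maximal: "hyp n B C \<longleftrightarrow> adj n B C"
proof -
  have "\<not> perp B C" if "adj n B C"
  proof (rule maximal_not_perp)
    show "B \<in> TI n" "C \<in> TI n" using that by (auto simp: adj_def)
    show "B \<noteq> C" using that adj_irrefl by blast
  qed
  then show ?thesis by (auto simp: adj_def hyp_def)
qed

text \<open>Meeting in a hyperplane splits into two relations, each of which automorphisms turn out
  to preserve; this makes the description in \<open>star_iff\<close> invariant.\<close>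

lemma adj_or_hyp:
  "adj k B C \<or> hyp k B C \<longleftrightarrow> B \<in> TI k \<and> C \<in> TI k \<and> Suc (dim (B \<inter> C)) = k"
proof (cases "k = n")
  case True
  then show ?thesis by (auto simp: hyp_maximal adj_def)
next
  case False
  then show ?thesis using TI_le[of k] by (auto simp: adj_def hyp_def)
qed

lemma Int_hyperplane:
  assumes "B \<in> TI k" "C \<in> TI k" "B \<noteq> C" "subspace A" "A \<subseteq> B \<inter> C" "Suc (dim A) = k"
  shows "B \<inter> C = A"
proof -
  have "dim (B \<inter> C) < k"
    using dim_Int_less[of B C] TI_D[OF assms(1)] TI_D[OF assms(2)] assms(3) by simp
  then show ?thesis
    using subspace_eqI[OF assms(4) subspace_inter[OF TI_D(2)[OF assms(1)] TI_D(2)[OF assms(2)]] assms(5)]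
      assms(6) by simp
qed

lemma hyperplanes_span:
  assumes "subspace B" "subspace E" "E \<subseteq> B" "F \<subseteq> B" "dim B = Suc (dim E)" "\<not> F \<subseteq> E"
  shows "span (E \<union> F) = B"
proof
  show "span (E \<union> F) \<subseteq> B" using assms by (intro span_minimal) auto
  obtain x where x: "x \<in> F" "x \<notin> E" using assms(6) by blast
  then have "span (insert x E) = B" using assms by (intro subspace_insert_eq) auto
  moreover have "span (insert x E) \<subseteq> span (E \<union> F)" using x by (intro span_mono) auto
  ultimately show "B \<subseteq> span (E \<union> F)" by simp
qed

text \<open>Suppose \<open>X\<close> meets both spaces in hyperplanes without containing
  \<open>B \<inter> C\<close>. Then \<open>B\<close> is generated by \<open>X \<inter> B\<close> and
  \<open>B \<inter> C\<close>, and \<open>C\<close> by \<open>X \<inter> C\<close> and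
  \<open>B \<inter> C\<close>. Any two of these pieces lie together in \<open>X\<close>,
  \<open>B\<close> or \<open>C\<close>, so \<open>B\<close> would be orthogonal to
  \<open>C\<close>.\<close>

lemma star_iff:
  assumes "hyp k B C" "X \<in> TI k"
  shows "B \<inter> C \<subseteq> X \<longleftrightarrow> (X = B \<or> adj k X B \<or> hyp k X B) \<and> (X = C \<or> adj k X C \<or> hyp k X C)"
proof -
  have B: "B \<in> TI k" and C: "C \<in> TI k" and d: "Suc (dim (B \<inter> C)) = k" and np: "\<not> perp B C"
    using assms by (auto simp: hyp_def)
  note sub = TI_D(2)[OF B] TI_D(2)[OF C] TI_D(2)[OF assms(2)]
  note dims = TI_D(3)[OF B] TI_D(3)[OF C]
  show ?thesis
    unfolding adj_or_hyp
  proof (intro iffI)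
    assume *: "B \<inter> C \<subseteq> X"
    have "X = B \<or> X \<inter> B = B \<inter> C" "X = C \<or> X \<inter> C = B \<inter> C"
      using Int_hyperplane[OF assms(2) B _ subspace_inter[OF sub(1,2)]]
        Int_hyperplane[OF assms(2) C _ subspace_inter[OF sub(1,2)]] * d by auto
    then show "(X = B \<or> X \<in> TI k \<and> B \<in> TI k \<and> Suc (dim (X \<inter> B)) = k) \<and>
        (X = C \<or> X \<in> TI k \<and> C \<in> TI k \<and> Suc (dim (X \<inter> C)) = k)"
      by (metis B C d assms(2))
  next
    assume *: "(X = B \<or> X \<in> TI k \<and> B \<in> TI k \<and> Suc (dim (X \<inter> B)) = k) \<and>
        (X = C \<or> X \<in> TI k \<and> C \<in> TI k \<and> Suc (dim (X \<inter> C)) = k)"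
    show "B \<inter> C \<subseteq> X"
    proof (rule ccontr)
      assume ns: "\<not> B \<inter> C \<subseteq> X"
      then have dX: "Suc (dim (X \<inter> B)) = k" "Suc (dim (X \<inter> C)) = k" using * by auto
      have "span ((X \<inter> B) \<union> (B \<inter> C)) = B" "span ((X \<inter> C) \<union> (B \<inter> C)) = C"
        using ns dX dims sub by (intro hyperplanes_span; auto intro: subspace_inter)+
      moreover have "perp ((X \<inter> B) \<union> (B \<inter> C)) ((X \<inter> C) \<union> (B \<inter> C))"
        using TI_D(1)[OF assms(2)] TI_D(1)[OF B] TI_D(1)[OF C] by (auto simp: perp_def ti_def)
      ultimately show False using np perp_span by metis
    qed
  qed
qed

lemma adj_insert:
  assumes "A \<in> TI j" "sing u" "sing v" "perp A {u, v}" "u \<notin> A" "v \<notin> A" "orth u v"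
    "span (insert u A) \<noteq> span (insert v A)"
  shows "adj (Suc j) (span (insert u A)) (span (insert v A))"
proof -
  let ?U = "span (insert u A)" and ?V = "span (insert v A)"
  have UV: "?U \<in> TI (Suc j)" "?V \<in> TI (Suc j)"
    using assms by (auto intro!: TI_insert simp: perp_def)
  have "A \<subseteq> ?U \<inter> ?V" by (auto intro: span_base)
  then have "?U \<inter> ?V = A"
    using TI_D[OF assms(1)] assms(8) by (intro Int_hyperplane[OF UV]) auto
  moreover have "perp (insert u A) (insert v A)"
    using assms(4,7) TI_D(1)[OF assms(1)] orth_sym unfolding perp_def ti_def by blast
  ultimately show ?thesis
    using UV TI_D(3)[OF assms(1)] perp_span by (simp add: adj_def)
qed

text \<open>Modulo \<open>A = B \<inter> C\<close>, the common neighbours are the singular points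
  orthogonal to a hyperbolic pair \<open>e\<close>, \<open>f\<close>. This polar space of rank
  \<open>n - k\<close> is reached from an \<open>(n - 1)\<close>-space \<open>E\<close> through
  \<open>B\<close>: thickness gives three vectors over \<open>E\<close>, which are then corrected to
  be orthogonal to \<open>f\<close>.\<close>

lemma common_neighbours_hyp:
  assumes "hyp k B C" "k < n"
  obtains Z1 Z2 Z3 where
    "\<forall>Z\<in>{Z1, Z2, Z3}. adj k Z B \<and> adj k Z C"
    "distinct [Z1, Z2, Z3]" "\<not> adj k Z1 Z2" "\<not> adj k Z1 Z3" "\<not> adj k Z2 Z3"
    "Suc k < n \<longrightarrow> (\<exists>Y. adj k Y B \<and> adj k Y C \<and> adj k Y Z1 \<and> adj k Y Z2 \<and> adj k Y Z3)"
proof -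
  define A where "A = B \<inter> C"
  define j where "j = dim A"
  have B: "B \<in> TI k" and C: "C \<in> TI k" and k: "k = Suc j" and np: "\<not> perp B C"
    using assms by (auto simp: hyp_def A_def j_def)
  note tB = TI_D(1)[OF B] and tC = TI_D(1)[OF C]
  have A: "A \<in> TI j"
    unfolding A_def j_def using ti_Int[OF tB TI_D(2)[OF C]] by (simp add: TI_def)
  obtain e f where e: "e \<in> B" and f: "f \<in> C" and ef: "\<not> orth e f" using np by (auto simp: perp_def)
  have sef: "sing e" "sing f" using e f tB tC by (auto simp: ti_def)
  have pA: "perp A {e, f}" using e f tB tC unfolding A_def ti_def perp_def by auto
  have nA: "e \<notin> A" "f \<notin> A" using hyperbolic_not_mem[OF TI_D(1)[OF A] pA ef] by auto
  have Beq: "B = span (insert e A)" and Ceq: "C = span (insert f A)"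
    using nA e f TI_D[OF A] TI_D[OF B] TI_D[OF C] k
    by (intro subspace_insert_eq[symmetric]; simp add: A_def)+
  obtain E where E: "E \<in> TI (n - 1)" "B \<subseteq> E"
    by (rule TI_extend[OF B, of "n - 1"]) (use \<open>k < n\<close> in auto)
  note tE = TI_D(1)[OF E(1)]
  have AE: "A \<subseteq> E" using E A_def by blast
  obtain m1 m2 m3 where m: "sing m1" "sing m2" "sing m3" "perp E {m1, m2, m3}"
    "\<not> orth m1 m2" "\<not> orth m1 m3" "\<not> orth m2 m3"
    using hyperbolic_triple[OF E(1)] \<open>k < n\<close> by auto
  \<comment> \<open>The three vectors are orthogonal to \<open>E\<close>, hence to \<open>e\<close>,
    but perhaps not to \<open>f\<close>. Subtracting multiples of \<open>e\<close> repairs this; as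
    \<open>e\<close> is singular and orthogonal to them, their singularity and mutual
    non-orthogonality survive.\<close>
  have "\<not> orth f e" using ef orth_sym by blast
  then obtain c1 c2 c3 where
    c: "orth f (m1 - scale c1 e)" "orth f (m2 - scale c2 e)" "orth f (m3 - scale c3 e)"
    using orth_hyperplane by meson
  have eE: "e \<in> E" using e E by blast
  have sh_sing: "sing (m - scale c e)" and sh_perp: "perp E {m - scale c e}"
    if "sing m" "perp E {m}" for m c
  proof -
    have "orth m e" using that eE orth_sym by (auto simp: perp_def)
    then have "sing (m + scale (- c) e)" using that sef by (intro sing_add sing_scale orth_scale)
    then show "sing (m - scale c e)" by simp
    show "perp E {m - scale c e}"
      using that eE tE unfolding perp_def ti_def by (auto intro!: orth_diff orth_scale)
  qed
  have sh_orth: "\<not> orth (m - scale c e) (m' - scale c' e)"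
    if "perp E {m, m'}" "\<not> orth m m'" for m m' c c'
  proof
    have em: "orth e m" "orth e m'" "orth e e" "orth m e" using that eE orth_sym sing_orth sef by (auto simp: perp_def)
    assume "orth (m - scale c e) (m' - scale c' e)"
    then have "orth (m' - scale c' e) (m - scale c e)" by (rule orth_sym)
    moreover have "orth (m' - scale c' e) (scale c e)"
      by (rule orth_scale, rule orth_sym) (use em in \<open>intro orth_diff orth_scale\<close>)
    ultimately have "orth (m' - scale c' e) m"
      using orth_add[of "m' - scale c' e" "m - scale c e" "scale c e"] by simp
    then have "orth m (m' - scale c' e)" by (rule orth_sym)
    moreover have "orth m (scale c' e)" using em by (intro orth_scale)
    ultimately have "orth m m'" using orth_add[of m "m' - scale c' e" "scale c' e"] by simp
    then show False using that by simp
  qed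
  define p1 where "p1 = m1 - scale c1 e"
  define p2 where "p2 = m2 - scale c2 e"
  define p3 where "p3 = m3 - scale c3 e"
  have pm: "perp E {m1}" "perp E {m2}" "perp E {m3}" "perp E {m1, m2}" "perp E {m1, m3}" "perp E {m2, m3}"
    using m(4) by (auto simp: perp_def)
  have sp: "sing p1" "sing p2" "sing p3"
    and pp: "perp E {p1}" "perp E {p2}" "perp E {p3}"
    and np': "\<not> orth p1 p2" "\<not> orth p1 p3" "\<not> orth p2 p3"
    unfolding p1_def p2_def p3_def using sh_sing sh_perp sh_orth m pm by blast+
  have pf: "orth f p1" "orth f p2" "orth f p3" using c by (auto simp: p1_def p2_def p3_def)
  have nE: "p1 \<notin> E" "p2 \<notin> E" "p3 \<notin> E"
    using pp np' orth_sym unfolding perp_def by blast+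
  have nbr: "adj k (span (insert x A)) B \<and> adj k (span (insert x A)) C"
    if "sing x" "orth x e" "orth x f" "perp A {x}" "x \<notin> A" for x
  proof -
    have orthx: "orth u v" if "u \<in> insert x A" "v \<in> insert e (insert f A)" for u v
      using that \<open>orth x e\<close> \<open>orth x f\<close> \<open>perp A {x}\<close> pA TI_D(1)[OF A] orth_sym
      unfolding perp_def ti_def by blast
    then have "perp (span (insert x A)) B" "perp (span (insert x A)) C"
      unfolding Beq Ceq by (intro perp_span; simp add: perp_def)+
    then have "span (insert x A) \<noteq> B" "span (insert x A) \<noteq> C"
      using np perp_sym by blast+
    moreover have "perp A {x, e}" "perp A {x, f}"
      using pA \<open>perp A {x}\<close> by (auto simp: perp_def)
    ultimately show ?thesis
      using adj_insert[OF A, of x e] adj_insert[OF A, of x f] that sef nA unfolding k Beq Ceq by blast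
  qed
  define Z where "Z x = span (insert x A)" for x
  have Zp: "adj k (Z p) B \<and> adj k (Z p) C" if "sing p" "perp E {p}" "orth f p" "p \<notin> E" for p
    unfolding Z_def using that AE eE orth_sym unfolding perp_def by (intro nbr) (auto simp: perp_def)
  have Znp: "\<not> perp (Z p) (Z q)" if "\<not> orth p q" for p q
    using that unfolding Z_def perp_def by (auto intro: span_base)
  have Zna: "\<not> adj k (Z p) (Z q)" "Z p \<noteq> Z q" if "\<not> orth p q" "sing p" "perp E {p}" "orth f p" "p \<notin> E" for p q
    using Znp[OF that(1)] Zp[OF that(2-)] \<open>k < n\<close> ti_perp[of "Z p" "Z p" "Z p"] TI_D(1)[of "Z p" k]
    by (auto simp: adj_def)
  show ?thesis
  proof (rule that[of "Z p1" "Z p2" "Z p3"])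
    show "\<forall>W\<in>{Z p1, Z p2, Z p3}. adj k W B \<and> adj k W C"
      using Zp sp pp pf nE by simp
    show "distinct [Z p1, Z p2, Z p3]" "\<not> adj k (Z p1) (Z p2)" "\<not> adj k (Z p1) (Z p3)" "\<not> adj k (Z p2) (Z p3)"
      using Zna np' sp pp pf nE by auto
    show "Suc k < n \<longrightarrow> (\<exists>Y. adj k Y B \<and> adj k Y C \<and> adj k Y (Z p1) \<and> adj k Y (Z p2) \<and> adj k Y (Z p3))"
    proof
      assume "Suc k < n"
      \<comment> \<open>\<open>E\<close> has dimension \<open>n - 1\<close>, so its vectors
        orthogonal to \<open>f\<close> fill at least \<open>n - 2\<close> dimensions, more than
        \<open>dim A = k - 1\<close>. A vector \<open>y\<close> found there is orthogonal to
        \<open>p1\<close>, \<open>p2\<close> and \<open>p3\<close> because these are orthogonal to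
        \<open>E\<close>.\<close>
      have "\<not> E \<inter> {y. orth f y} \<subseteq> A"
      proof
        assume "E \<inter> {y. orth f y} \<subseteq> A"
        then have "dim (E \<inter> {y. orth f y}) \<le> j" unfolding j_def by (rule dim_subset)
        moreover have "dim E \<le> Suc (dim (E \<inter> {y. orth f y}))" using dim_Int_orth TI_D(2)[OF E(1)] by blast
        ultimately show False using \<open>Suc k < n\<close> k TI_D(3)[OF E(1)] by simp
      qed
      then obtain y where y: "y \<in> E" "orth f y" "y \<notin> A" by blast
      have sy: "sing y" "orth y e" "orth y f" "perp A {y}"
        using y tE eE AE orth_sym unfolding ti_def perp_def by auto
      have "adj k (Z y) B \<and> adj k (Z y) C" using nbr[OF sy y(3)] by (simp add: Z_def)
      moreover have "adj k (Z y) (Z p)" if "sing p" "perp E {p}" "p \<notin> E" for p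
      proof -
        have "Z y \<subseteq> E" unfolding Z_def using y AE TI_D(2)[OF E(1)] by (intro span_minimal) auto
        moreover have "p \<in> Z p" by (simp add: Z_def span_base)
        ultimately have "Z y \<noteq> Z p" using that by blast
        moreover have "orth y p" "perp A {y, p}" "p \<notin> A"
          using y AE that sy by (auto simp: perp_def)
        ultimately show ?thesis unfolding k Z_def using sy(1) y(3) that(1) by (intro adj_insert[OF A])
      qed
      ultimately show "\<exists>Y. adj k Y B \<and> adj k Y C \<and> adj k Y (Z p1) \<and> adj k Y (Z p2) \<and> adj k Y (Z p3)"
        using sp pp nE by blast
    qed
  qed
qed


text \<open>The traces on \<open>B\<close> and \<open>C\<close> are hyperplanes of \<open>Z\<close>,
  so they meet in dimension at least \<open>k - 2\<close>; they meet inside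
  \<open>B \<inter> C\<close>, which has just that dimension.\<close>

lemma common_neighbour:
  assumes Z: "adj k Z B" "adj k Z C" and BC: "Suc (Suc (dim (B \<inter> C))) = k"
  shows "B \<inter> C \<subseteq> Z" "span ((Z \<inter> B) \<union> (Z \<inter> C)) = Z"
    "dim (Z \<inter> B) = Suc (dim (B \<inter> C))" "dim (Z \<inter> C) = Suc (dim (B \<inter> C))"
proof -
  have s: "subspace Z" "subspace B" "subspace C" and dZ: "dim Z = k"
    using Z TI_D(2,3) by (auto simp: adj_def)
  show d: "dim (Z \<inter> B) = Suc (dim (B \<inter> C))" "dim (Z \<inter> C) = Suc (dim (B \<inter> C))"
    using Z BC by (auto simp: adj_def)
  have sE: "subspace (Z \<inter> B)" "subspace (Z \<inter> C)" using s by (auto intro: subspace_inter)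
  have le: "span ((Z \<inter> B) \<union> (Z \<inter> C)) \<subseteq> Z" using s by (intro span_minimal) auto
  have "dim (span ((Z \<inter> B) \<union> (Z \<inter> C))) \<le> k" using dim_subset[OF le] dZ by simp
  moreover note dim_span_Un[OF sE]
  ultimately have "dim (B \<inter> C) \<le> dim ((Z \<inter> B) \<inter> (Z \<inter> C))" using d BC by linarith
  then have eq: "(Z \<inter> B) \<inter> (Z \<inter> C) = B \<inter> C"
    using s sE by (intro subspace_eqI) (auto intro: subspace_inter)
  then show "B \<inter> C \<subseteq> Z" by blast
  have "dim (span ((Z \<inter> B) \<union> (Z \<inter> C))) = k"
    using dim_span_Un[OF sE] d BC eq by simp
  then show "span ((Z \<inter> B) \<union> (Z \<inter> C)) = Z"
    using s dZ le by (intro subspace_eqI) auto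
qed

text \<open>The trace of \<open>Z\<close> on \<open>B\<close> is orthogonal to \<open>C\<close>, and
  the part of \<open>B\<close> orthogonal to \<open>C\<close> is a proper subspace, hence no larger
  than this hyperplane. Used on both sides, this leaves at most one common neighbour.\<close>

lemma common_neighbour_unique:
  assumes Z: "adj k Z B" "adj k Z C" and BC: "Suc (Suc (dim (B \<inter> C))) = k"
    and np: "\<not> perp B C" and "k < n"
  shows "Z \<inter> B = B \<inter> {y. \<forall>x\<in>C. orth x y}"
proof (rule subspace_eqI)
  have B: "B \<in> TI k" and C: "C \<in> TI k" using Z by (auto simp: adj_def)
  show "subspace (Z \<inter> B)" "subspace (B \<inter> {y. \<forall>x\<in>C. orth x y})"
    using Z TI_D(2) by (auto simp: adj_def intro!: subspace_inter subspace_perp)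
  show "Z \<inter> B \<subseteq> B \<inter> {y. \<forall>x\<in>C. orth x y}"
    using Z(2) \<open>k < n\<close> orth_sym by (auto simp: adj_def perp_def)
  have "B \<inter> {y. \<forall>x\<in>C. orth x y} \<subset> B"
    using np orth_sym by (auto simp: perp_def)
  then have "dim (B \<inter> {y. \<forall>x\<in>C. orth x y}) < dim B"
    using TI_D(2)[OF B] by (intro dim_psubset) (simp add: span_eq_iff[THEN iffD2] subspace_inter subspace_perp)
  then show "dim (B \<inter> {y. \<forall>x\<in>C. orth x y}) \<le> dim (Z \<inter> B)"
    using common_neighbour(3)[OF Z BC] BC TI_D(3)[OF B] by simp
qed

text \<open>If \<open>B \<bottom> C\<close> and \<open>B \<inter> C\<close> has codimension 2, the common neighbours of \<open>B\<close> and \<open>C\<close> form a grid: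
  the lines through \<open>Y\<close> consist of the \<open>Z\<close> with the same trace on \<open>B\<close>, respectively on \<open>C\<close>.\<close>

lemma grid_neighbours:
  assumes Y: "adj k Y B" "adj k Y C" and Z: "adj k Z B" "adj k Z C"
    and BC: "Suc (Suc (dim (B \<inter> C))) = k" and YZ: "adj k Y Z"
  shows "Z \<inter> B = Y \<inter> B \<or> Z \<inter> C = Y \<inter> C"
proof (rule ccontr)
  let ?D = "B \<inter> C"
  assume neg: "\<not> ?thesis"
  note cY = common_neighbour[OF Y BC] and cZ = common_neighbour[OF Z BC]
  have s: "subspace Y" "subspace Z" "subspace B" "subspace C"
    using Y Z TI_D(2) by (auto simp: adj_def)
  have D_eq: "(Y \<inter> X) \<inter> (Z \<inter> X) = ?D"
    if "subspace X" "?D \<subseteq> X" "dim (Y \<inter> X) = Suc (dim ?D)" "dim (Z \<inter> X) = Suc (dim ?D)"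
      "Z \<inter> X \<noteq> Y \<inter> X" for X
  proof -
    have "subspace (Y \<inter> X)" "subspace (Z \<inter> X)" using s that by (auto intro: subspace_inter)
    moreover from this have "dim ((Y \<inter> X) \<inter> (Z \<inter> X)) < Suc (dim ?D)"
      using dim_Int_less[of "Y \<inter> X" "Z \<inter> X"] that by auto
    moreover have "?D \<subseteq> (Y \<inter> X) \<inter> (Z \<inter> X)" using that(2) cY(1) cZ(1) by blast
    ultimately show ?thesis using s that(1) by (intro subspace_eqI[symmetric] subspace_inter) auto
  qed
  have DB: "(Y \<inter> B) \<inter> (Z \<inter> B) = ?D" and DC: "(Y \<inter> C) \<inter> (Z \<inter> C) = ?D"
    using D_eq[of B] D_eq[of C] s cY cZ neg by auto
  \<comment> \<open>Splitting \<open>x\<close> along the traces of \<open>Y\<close> and of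
    \<open>Z\<close> gives \<open>a + a' = b + b'\<close>, and \<open>a - b = b' - a'\<close> lies
    in \<open>B \<inter> C\<close>, hence in \<open>Y\<close>. So \<open>b\<close> and
    \<open>b'\<close> lie in \<open>Y\<close> too, and by \<open>DB\<close> and \<open>DC\<close> in
    \<open>B \<inter> C\<close>. Thus \<open>Y \<inter> Z\<close> is too small for
    adjacency.\<close>
  have "Y \<inter> Z \<subseteq> ?D"
  proof
    fix x assume x: "x \<in> Y \<inter> Z"
    have sp: "span (X \<inter> B \<union> X \<inter> C) = {u + v |u v. u \<in> X \<inter> B \<and> v \<in> X \<inter> C}" if "subspace X" for X
      using that s by (simp add: span_Un span_eq_iff[THEN iffD2] subspace_inter)
    obtain a a' where a: "a \<in> Y \<inter> B" "a' \<in> Y \<inter> C" "x = a + a'"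
      using x cY(2) sp[OF s(1)] by blast
    obtain b b' where b: "b \<in> Z \<inter> B" "b' \<in> Z \<inter> C" "x = b + b'"
      using x cZ(2) sp[OF s(2)] by blast
    have eq: "a - b = b' - a'" using a(3) b(3) by (simp add: algebra_simps)
    have "a - b \<in> B" using a b s by (intro subspace_diff) auto
    moreover have "a - b \<in> C" unfolding eq using a b s by (intro subspace_diff) auto
    ultimately have d: "a - b \<in> ?D" by simp
    then have "a - b \<in> Y" using cY(1) by blast
    then have "a - (a - b) \<in> Y" using subspace_diff[OF s(1)] a(1) by blast
    then have bD: "b \<in> ?D" using b DB by auto
    have "b' - a' \<in> Y" using d eq cY(1) by auto
    then have "(b' - a') + a' \<in> Y" using subspace_add[OF s(1)] a(2) by blast
    then have b'D: "b' \<in> ?D" using b DC by auto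
    show "x \<in> ?D" unfolding b(3) using bD b'D s by (intro subspace_add subspace_inter)
  qed
  then have "dim (Y \<inter> Z) \<le> dim ?D" by (rule dim_subset)
  then show False using YZ BC by (auto simp: adj_def)
qed

lemma adj_trace:
  assumes "adj k Z X" "adj k Z' X" "Z \<inter> X = Z' \<inter> X" "Z \<noteq> Z'" "perp Z Z'"
  shows "adj k Z Z'"
proof -
  have Z: "Z \<in> TI k" "Z' \<in> TI k" "X \<in> TI k" "Suc (dim (Z \<inter> X)) = k" using assms by (auto simp: adj_def)
  have "Z \<inter> Z' = Z \<inter> X"
    using Z assms(3) by (intro Int_hyperplane[OF Z(1,2) assms(4)] subspace_inter TI_D) auto
  then show ?thesis using Z assms by (simp add: adj_def)
qed

text \<open>The right-hand side speaks of \<open>adj\<close> alone, so automorphisms preserve it.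
  For the converse, a common neighbour bounds the codimension of \<open>B \<inter> C\<close> by 2.
  In codimension 1 only the hyperbolic case is left; in codimension 2 a non-orthogonal pair has too
  few common neighbours, and an orthogonal pair only a grid of them.\<close>

lemma hyp_iff:
  assumes "k < n" "B \<in> TI k" "C \<in> TI k"
  shows "hyp k B C \<longleftrightarrow> B \<noteq> C \<and> \<not> adj k B C \<and>
    (\<exists>Z1 Z2 Z3. (\<forall>Z\<in>{Z1, Z2, Z3}. adj k Z B \<and> adj k Z C) \<and> distinct [Z1, Z2, Z3] \<and>
       \<not> adj k Z1 Z2 \<and> \<not> adj k Z1 Z3 \<and> \<not> adj k Z2 Z3 \<and>
       (Suc k < n \<longrightarrow> (\<exists>Y. adj k Y B \<and> adj k Y C \<and> adj k Y Z1 \<and> adj k Y Z2 \<and> adj k Y Z3)))"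
    (is "_ \<longleftrightarrow> ?rhs")
proof
  assume h: "hyp k B C"
  then have "B \<noteq> C" "\<not> adj k B C" using hyp_irrefl \<open>k < n\<close> by (auto simp: adj_def hyp_def)
  moreover obtain Z1 Z2 Z3 where
    "\<forall>Z\<in>{Z1, Z2, Z3}. adj k Z B \<and> adj k Z C"
    "distinct [Z1, Z2, Z3]" "\<not> adj k Z1 Z2" "\<not> adj k Z1 Z3" "\<not> adj k Z2 Z3"
    "Suc k < n \<longrightarrow> (\<exists>Y. adj k Y B \<and> adj k Y C \<and> adj k Y Z1 \<and> adj k Y Z2 \<and> adj k Y Z3)"
    using common_neighbours_hyp[OF h \<open>k < n\<close>] .
  ultimately show ?rhs by blast
next
  assume r: ?rhs
  then obtain Z1 Z2 Z3 where Z: "\<forall>Z\<in>{Z1, Z2, Z3}. adj k Z B \<and> adj k Z C"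
    "distinct [Z1, Z2, Z3]" "\<not> adj k Z1 Z2" "\<not> adj k Z1 Z3" "\<not> adj k Z2 Z3"
    and Y: "Suc k < n \<Longrightarrow> \<exists>Y. adj k Y B \<and> adj k Y C \<and> adj k Y Z1 \<and> adj k Y Z2 \<and> adj k Y Z3"
    by blast
  have Z1: "adj k Z1 B" "adj k Z1 C" and Z2: "adj k Z2 B" "adj k Z2 C" and Z3: "adj k Z3 B" "adj k Z3 C"
    using Z(1) by auto
  have s: "subspace B" "subspace C" "subspace Z1" and dims: "dim B = k" "dim C = k" "dim Z1 = k"
    using assms Z1 TI_D(2,3) by (auto simp: adj_def)
  have sE: "subspace (Z1 \<inter> B)" "subspace (Z1 \<inter> C)" using s by (auto intro: subspace_inter)
  have "dim (span ((Z1 \<inter> B) \<union> (Z1 \<inter> C))) \<le> dim Z1"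
    using s by (intro dim_subset span_minimal) auto
  moreover have "dim ((Z1 \<inter> B) \<inter> (Z1 \<inter> C)) \<le> dim (B \<inter> C)" by (intro dim_subset) auto
  moreover have "Suc (dim (Z1 \<inter> B)) = k" "Suc (dim (Z1 \<inter> C)) = k" using Z1 by (auto simp: adj_def)
  ultimately have ge: "k \<le> Suc (Suc (dim (B \<inter> C)))"
    using dim_span_Un[OF sE] dims by linarith
  have "dim (B \<inter> C) < k" using dim_Int_less[OF s(1,2)] dims r by simp
  with ge consider "Suc (dim (B \<inter> C)) = k" | "Suc (Suc (dim (B \<inter> C))) = k" by linarith
  then show "hyp k B C"
  proof cases
    case 1
    then show ?thesis using r assms adj_or_hyp[of k B C] by auto
  next
    case 2
    have CB: "Suc (Suc (dim (C \<inter> B))) = k" using 2 by (simp add: Int_commute)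
    show ?thesis
    proof (cases "perp B C")
      case False
      then have False': "\<not> perp C B" using perp_sym by blast
      have "Z1 \<inter> B = Z2 \<inter> B" "Z1 \<inter> C = Z2 \<inter> C"
        using common_neighbour_unique[OF Z1 2 False \<open>k < n\<close>] common_neighbour_unique[OF Z2 2 False \<open>k < n\<close>]
          common_neighbour_unique[OF Z1(2,1) CB False' \<open>k < n\<close>]
          common_neighbour_unique[OF Z2(2,1) CB False' \<open>k < n\<close>] by simp_all
      then have "Z1 = Z2" using common_neighbour(2)[OF Z1 2] common_neighbour(2)[OF Z2 2] by metis
      then show ?thesis using Z(2) by simp
    next
      case True
      have ti: "ti (span (B \<union> C))" using assms TI_D(1) True by (intro ti_Un) auto
      have "dim (span (B \<union> C)) = Suc (Suc k)" using dim_span_Un[OF s(1,2)] dims 2 by linarith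
      \<comment> \<open>The totally isotropic span of \<open>B\<close> and \<open>C\<close> has
        dimension \<open>k + 2\<close>, so this case arises only when the fourth space
        \<open>Y\<close> is available.\<close>
      then have "Suc k < n" using ti_dim_le[OF ti] by simp
      then obtain Y where Yn: "adj k Y B" "adj k Y C"
        and YZ: "adj k Y Z1" "adj k Y Z2" "adj k Y Z3" using Y by blast
      have sub: "W \<subseteq> span (B \<union> C)" if "adj k W B" "adj k W C" for W
      proof -
        have "span ((W \<inter> B) \<union> (W \<inter> C)) \<subseteq> span (B \<union> C)" by (intro span_mono) blast
        then show ?thesis using common_neighbour(2)[OF that 2] by simp
      qed
      have p: "perp Z1 Z2" "perp Z1 Z3" "perp Z2 Z3" using ti_perp[OF ti] sub Z1 Z2 Z3 by auto
      have d: "Z1 \<noteq> Z2" "Z1 \<noteq> Z3" "Z2 \<noteq> Z3" using Z(2) by auto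
      \<comment> \<open>Pigeonhole: each of the three shares with \<open>Y\<close> its trace on
        \<open>B\<close> or its trace on \<open>C\<close>, so two of them share the same trace and
        are adjacent by \<open>adj_trace\<close>.\<close>
      have "Z1 \<inter> B = Y \<inter> B \<or> Z1 \<inter> C = Y \<inter> C" "Z2 \<inter> B = Y \<inter> B \<or> Z2 \<inter> C = Y \<inter> C"
        "Z3 \<inter> B = Y \<inter> B \<or> Z3 \<inter> C = Y \<inter> C"
        using grid_neighbours[OF Yn _ _ 2] Z1 Z2 Z3 YZ by blast+
      then show ?thesis
        using adj_trace[OF Z1(1) Z2(1) _ d(1) p(1)] adj_trace[OF Z1(2) Z2(2) _ d(1) p(1)]
          adj_trace[OF Z1(1) Z3(1) _ d(2) p(2)] adj_trace[OF Z1(2) Z3(2) _ d(2) p(2)]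
          adj_trace[OF Z2(1) Z3(1) _ d(3) p(3)] adj_trace[OF Z2(2) Z3(2) _ d(3) p(3)] Z(3-5) by argo
    qed
  qed
qed

section \<open>Recovering the points\<close>

definition adj_auto :: "nat \<Rightarrow> ('w set \<Rightarrow> 'w set) \<Rightarrow> bool" where
  "adj_auto k g \<longleftrightarrow> bij_betw g (TI k) (TI k) \<and> (\<forall>B\<in>TI k. \<forall>C\<in>TI k. adj k (g B) (g C) \<longleftrightarrow> adj k B C)"

lemma adj_auto_mem: "adj_auto k g \<Longrightarrow> B \<in> TI k \<Longrightarrow> g B \<in> TI k"
  by (auto simp: adj_auto_def bij_betw_def)

lemma adj_auto_eq_iff: "adj_auto k g \<Longrightarrow> B \<in> TI k \<Longrightarrow> C \<in> TI k \<Longrightarrow> g B = g C \<longleftrightarrow> B = C"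
  by (auto simp: adj_auto_def bij_betw_def inj_on_def)

lemma adj_auto_inv:
  assumes "adj_auto k g"
  shows "adj_auto k (inv_into (TI k) g)"
  unfolding adj_auto_def
proof (intro conjI ballI)
  have b: "bij_betw g (TI k) (TI k)" using assms by (simp add: adj_auto_def)
  show bi: "bij_betw (inv_into (TI k) g) (TI k) (TI k)" using bij_betw_inv_into[OF b] .
  fix B C assume BC: "B \<in> TI k" "C \<in> TI k"
  then have "inv_into (TI k) g B \<in> TI k" "inv_into (TI k) g C \<in> TI k"
    using bi by (auto simp: bij_betw_def)
  then show "adj k (inv_into (TI k) g B) (inv_into (TI k) g C) = adj k B C"
    using assms BC bij_betw_inv_into_right[OF b] unfolding adj_auto_def by metis
qed

lemma adj_auto_hyp_imp:
  assumes g: "adj_auto k g" and h: "hyp k B C"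
  shows "hyp k (g B) (g C)"
proof (cases "k < n")
  case False
  then have "k = n" using h TI_le[of k] by (auto simp: hyp_def)
  then show ?thesis using g h by (auto simp: hyp_maximal adj_auto_def adj_def)
next
  case True
  have BC: "B \<in> TI k" "C \<in> TI k" using h by (auto simp: hyp_def)
  have adj: "adj k (g X) (g Y) \<longleftrightarrow> adj k X Y" if "X \<in> TI k" "Y \<in> TI k" for X Y
    using g that by (simp add: adj_auto_def)
  have mem: "X \<in> TI k" if "adj k X Y" for X Y using that by (simp add: adj_def)
  obtain Z1 Z2 Z3 where Z: "\<forall>Z\<in>{Z1, Z2, Z3}. adj k Z B \<and> adj k Z C"
    "distinct [Z1, Z2, Z3]" "\<not> adj k Z1 Z2" "\<not> adj k Z1 Z3" "\<not> adj k Z2 Z3"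
    and Y: "Suc k < n \<longrightarrow> (\<exists>Y. adj k Y B \<and> adj k Y C \<and> adj k Y Z1 \<and> adj k Y Z2 \<and> adj k Y Z3)"
    using common_neighbours_hyp[OF h True] .
  have Zm: "Z1 \<in> TI k" "Z2 \<in> TI k" "Z3 \<in> TI k" using Z(1) mem by auto
  have "\<forall>Z\<in>{g Z1, g Z2, g Z3}. adj k Z (g B) \<and> adj k Z (g C)" using Z(1) adj BC Zm by simp
  moreover have "distinct [g Z1, g Z2, g Z3]" using Z(2) adj_auto_eq_iff[OF g] Zm by simp
  moreover have "\<not> adj k (g Z1) (g Z2)" "\<not> adj k (g Z1) (g Z3)" "\<not> adj k (g Z2) (g Z3)"
    using Z(3-5) adj Zm by simp_all
  moreover have "\<exists>Y. adj k Y (g B) \<and> adj k Y (g C) \<and> adj k Y (g Z1) \<and> adj k Y (g Z2) \<and> adj k Y (g Z3)"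
    if Suc: "Suc k < n"
  proof -
    obtain Y where Y: "adj k Y B \<and> adj k Y C \<and> adj k Y Z1 \<and> adj k Y Z2 \<and> adj k Y Z3"
      using Y Suc by blast
    then have "Y \<in> TI k" using mem by blast
    with Y show ?thesis using adj BC Zm by (intro exI[of _ "g Y"]) simp
  qed
  moreover have "g B \<noteq> g C" "\<not> adj k (g B) (g C)"
    using h BC True hyp_irrefl adj_auto_eq_iff[OF g] adj by (auto simp: adj_def hyp_def)
  ultimately show ?thesis
    unfolding hyp_iff[OF True adj_auto_mem[OF g BC(1)] adj_auto_mem[OF g BC(2)]] by blast
qed

lemma adj_auto_hyp:
  assumes g: "adj_auto k g" and BC: "B \<in> TI k" "C \<in> TI k"
  shows "hyp k (g B) (g C) \<longleftrightarrow> hyp k B C"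
proof
  assume "hyp k (g B) (g C)"
  then have "hyp k (inv_into (TI k) g (g B)) (inv_into (TI k) g (g C))"
    by (rule adj_auto_hyp_imp[OF adj_auto_inv[OF g]])
  then show "hyp k B C" using bij_betw_inv_into_left g BC unfolding adj_auto_def by metis
qed (rule adj_auto_hyp_imp[OF g])

section \<open>Descent from \<open>k\<close>-spaces to \<open>(k - 1)\<close>-spaces\<close>

lemma hyp_Int:
  assumes "hyp (Suc j) B C"
  shows "B \<inter> C \<in> TI j"
proof -
  have "ti (B \<inter> C)" using assms by (intro ti_Int TI_D) (auto simp: hyp_def)
  then show ?thesis using assms by (simp add: hyp_def TI_def)
qed

lemma hyp_exists:
  assumes "A \<in> TI j" "j < n"
  obtains B C where "hyp (Suc j) B C" "B \<inter> C = A"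
proof -
  obtain e f where ef: "sing e" "sing f" "perp A {e, f}" "\<not> orth e f"
    using hyperbolic_pair[OF assms] .
  have nA: "e \<notin> A" "f \<notin> A" using hyperbolic_not_mem[OF TI_D(1)[OF assms(1)] ef(3,4)] by auto
  let ?B = "span (insert e A)" and ?C = "span (insert f A)"
  have BC: "?B \<in> TI (Suc j)" "?C \<in> TI (Suc j)"
    using ef nA assms by (auto intro!: TI_insert simp: perp_def)
  have np: "\<not> perp ?B ?C" using ef by (auto simp: perp_def intro: span_base)
  then have "?B \<noteq> ?C" using ti_perp[OF TI_D(1)[OF BC(1)]] by auto
  moreover have "A \<subseteq> ?B \<inter> ?C" by (auto intro: span_base)
  ultimately have "?B \<inter> ?C = A"
    using TI_D[OF assms(1)] by (intro Int_hyperplane[OF BC]) auto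
  moreover from this have "hyp (Suc j) ?B ?C" using BC np TI_D(3)[OF assms(1)] by (simp add: hyp_def)
  ultimately show ?thesis using that by blast
qed

text \<open>The intersection runs over all \<open>k\<close>-spaces above \<open>A\<close>, so that
  no hyperbolic pair has to be chosen; for any such pair with intersection \<open>A\<close> it
  equals \<open>g B \<inter> g C\<close> by \<open>descend_hyp\<close>.\<close>

definition descend :: "nat \<Rightarrow> ('w set \<Rightarrow> 'w set) \<Rightarrow> 'w set \<Rightarrow> 'w set" where
  "descend k g A = \<Inter> (g ` {X \<in> TI k. A \<subseteq> X})"

text \<open>By \<open>star_iff\<close>, lying above \<open>B \<inter> C\<close> is expressed through
  relations to \<open>B\<close> and \<open>C\<close> that \<open>g\<close> preserves, so
  \<open>g\<close> carries the star of \<open>B \<inter> C\<close> to that of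
  \<open>g B \<inter> g C\<close>. As \<open>g B\<close> and \<open>g C\<close> are themselves among
  the images, the intersection is no larger.\<close>

lemma descend_hyp:
  assumes g: "adj_auto k g" and h: "hyp k B C"
  shows "descend k g (B \<inter> C) = g B \<inter> g C"
    and "X \<in> TI k \<Longrightarrow> g B \<inter> g C \<subseteq> g X \<longleftrightarrow> B \<inter> C \<subseteq> X"
proof -
  have BC: "B \<in> TI k" "C \<in> TI k" using h by (auto simp: hyp_def)
  show *: "g B \<inter> g C \<subseteq> g X \<longleftrightarrow> B \<inter> C \<subseteq> X" if X: "X \<in> TI k" for X
    unfolding star_iff[OF h X] star_iff[OF adj_auto_hyp_imp[OF g h] adj_auto_mem[OF g X]]
    using adj_auto_hyp[OF g] adj_auto_eq_iff[OF g] g X BC by (simp add: adj_auto_def)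
  show "descend k g (B \<inter> C) = g B \<inter> g C"
    using * BC by (auto simp: descend_def)
qed

lemma descend_mem:
  assumes g: "adj_auto (Suc j) g" and "j < n" and A: "A \<in> TI j"
  shows "descend (Suc j) g A \<in> TI j"
    and "X \<in> TI (Suc j) \<Longrightarrow> descend (Suc j) g A \<subseteq> g X \<longleftrightarrow> A \<subseteq> X"
proof -
  obtain B C where h: "hyp (Suc j) B C" "B \<inter> C = A" using hyp_exists[OF A \<open>j < n\<close>] .
  note d = descend_hyp[OF g h(1), unfolded h(2)]
  have "hyp (Suc j) (g B) (g C)" using adj_auto_hyp_imp[OF g h(1)] .
  then show "descend (Suc j) g A \<in> TI j"
    unfolding d by (rule hyp_Int)
  show "X \<in> TI (Suc j) \<Longrightarrow> descend (Suc j) g A \<subseteq> g X \<longleftrightarrow> A \<subseteq> X" using d by simp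
qed

text \<open>Below the top rank, collinearity can be read off from inclusion between
  \<open>j\<close>- and \<open>(j + 1)\<close>-spaces alone, and inclusion is what
  \<open>descend\<close> respects.\<close>

lemma adj_iff_common:
  assumes "j < n" "A \<in> TI j" "A' \<in> TI j"
  shows "adj j A A' \<longleftrightarrow> A \<noteq> A' \<and> (\<exists>B\<in>TI (Suc j). A \<subseteq> B \<and> A' \<subseteq> B)"
proof
  assume a: "adj j A A'"
  then have "ti (span (A \<union> A'))" using assms TI_D(1) by (intro ti_Un) (auto simp: adj_def)
  moreover have "dim (span (A \<union> A')) = Suc j"
    using dim_span_Un[OF TI_D(2)[OF assms(2)] TI_D(2)[OF assms(3)]] a TI_D(3) assms
    by (simp add: adj_def)
  ultimately have "span (A \<union> A') \<in> TI (Suc j)" by (simp add: TI_def)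
  moreover have "A \<subseteq> span (A \<union> A')" "A' \<subseteq> span (A \<union> A')" by (auto intro: span_base)
  ultimately show "A \<noteq> A' \<and> (\<exists>B\<in>TI (Suc j). A \<subseteq> B \<and> A' \<subseteq> B)" using a adj_irrefl by blast
next
  assume a: "A \<noteq> A' \<and> (\<exists>B\<in>TI (Suc j). A \<subseteq> B \<and> A' \<subseteq> B)"
  then obtain B where B: "B \<in> TI (Suc j)" "A \<subseteq> B" "A' \<subseteq> B" by blast
  note s = TI_D(2)[OF assms(2)] TI_D(2)[OF assms(3)] and d = TI_D(3)[OF assms(2)] TI_D(3)[OF assms(3)]
  have "dim (span (A \<union> A')) \<le> dim B" using B TI_D(2)[OF B(1)] by (intro dim_subset span_minimal) auto
  moreover have "dim (A \<inter> A') < j" using dim_Int_less[OF s] d a by simp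
  ultimately have "Suc (dim (A \<inter> A')) = j"
    using dim_span_Un[OF s] d TI_D(3)[OF B(1)] by linarith
  then show "adj j A A'" using assms ti_perp[OF TI_D(1)[OF B(1)] B(2,3)] by (simp add: adj_def)
qed

lemma adj_auto_descend:
  assumes g: "adj_auto (Suc j) g" and "j < n"
  shows "adj_auto j (descend (Suc j) g)"
proof -
  let ?d = "descend (Suc j) g"
  note d = descend_mem[OF g \<open>j < n\<close>]
  have surj: "\<exists>X\<in>TI (Suc j). g X = Y" if "Y \<in> TI (Suc j)" for Y
    using g that unfolding adj_auto_def bij_betw_def by (metis imageE)
  \<comment> \<open>A hyperbolic pair recovers \<open>A'\<close> as an intersection, and the
    \<open>(j + 1)\<close>-spaces above \<open>A\<close> can be read off from
    \<open>?d A\<close>.\<close>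
  have inj: "A = A'" if "A \<in> TI j" "A' \<in> TI j" "?d A = ?d A'" for A A'
  proof -
    have "A \<subseteq> A'" if A: "A \<in> TI j" "A' \<in> TI j" "?d A = ?d A'" for A A'
    proof -
      obtain B C where h: "hyp (Suc j) B C" "B \<inter> C = A'" using hyp_exists[OF A(2) \<open>j < n\<close>] .
      then have "B \<in> TI (Suc j)" "C \<in> TI (Suc j)" "A' \<subseteq> B" "A' \<subseteq> C" by (auto simp: hyp_def)
      then have "A \<subseteq> B" "A \<subseteq> C" using d(2)[OF A(1)] d(2)[OF A(2)] A(3) by metis+
      then show ?thesis using h by blast
    qed
    then show ?thesis using that by blast
  qed
  \<comment> \<open>A hyperbolic pair over the target is pulled back through \<open>g\<close>; it
    stays hyperbolic because \<open>hyp\<close> is preserved in both directions.\<close>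
  have onto: "\<exists>A\<in>TI j. ?d A = A'" if A': "A' \<in> TI j" for A'
  proof -
    obtain B' C' where h: "hyp (Suc j) B' C'" "B' \<inter> C' = A'" using hyp_exists[OF A' \<open>j < n\<close>] .
    then obtain B C where BC: "B \<in> TI (Suc j)" "C \<in> TI (Suc j)" "g B = B'" "g C = C'"
      using surj unfolding hyp_def by metis
    then have hBC: "hyp (Suc j) B C" using adj_auto_hyp[OF g BC(1,2)] h by simp
    then have "B \<inter> C \<in> TI j" by (rule hyp_Int)
    moreover have "?d (B \<inter> C) = A'" using descend_hyp(1)[OF g hBC] BC h by simp
    ultimately show ?thesis by blast
  qed
  have bij: "bij_betw ?d (TI j) (TI j)"
    using inj onto d(1) by (intro bij_betwI') blast+
  have "adj j (?d A) (?d A') \<longleftrightarrow> adj j A A'" if A: "A \<in> TI j" "A' \<in> TI j" for A A'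
  proof -
    have "(\<exists>B\<in>TI (Suc j). ?d A \<subseteq> B \<and> ?d A' \<subseteq> B) \<longleftrightarrow> (\<exists>B\<in>TI (Suc j). A \<subseteq> B \<and> A' \<subseteq> B)"
      using surj d(2)[OF A(1)] d(2)[OF A(2)] adj_auto_mem[OF g] by metis
    moreover have "?d A = ?d A' \<longleftrightarrow> A = A'" using inj A by blast
    ultimately show ?thesis
      using adj_iff_common[OF \<open>j < n\<close>] A d(1) by simp
  qed
  with bij show ?thesis by (auto simp: adj_auto_def)
qed

lemma adj_auto_points:
  assumes "adj_auto k g" "1 \<le> k" "k \<le> n"
  obtains h where "adj_auto 1 h" "\<And>p B. p \<in> TI 1 \<Longrightarrow> B \<in> TI k \<Longrightarrow> h p \<subseteq> g B \<longleftrightarrow> p \<subseteq> B"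
proof -
  have "\<exists>h. adj_auto 1 h \<and> (\<forall>p\<in>TI 1. \<forall>B\<in>TI k. h p \<subseteq> g B \<longleftrightarrow> p \<subseteq> B)"
    using assms(2,1,3)
  proof (induction k arbitrary: g rule: dec_induct)
    case base
    have "g p \<subseteq> g B \<longleftrightarrow> p \<subseteq> B" if pB: "p \<in> TI 1" "B \<in> TI 1" for p B
    proof -
      have eq: "U \<subseteq> V \<longleftrightarrow> U = V" if "U \<in> TI 1" "V \<in> TI 1" for U V
        using TI_D(2,3)[OF that(1)] TI_D(2,3)[OF that(2)] subspace_eqI[of U V] by auto
      show ?thesis
        using eq[OF pB] eq[OF adj_auto_mem[OF base(1) pB(1)] adj_auto_mem[OF base(1) pB(2)]]
          adj_auto_eq_iff[OF base(1) pB] by simp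
    qed
    then show ?case using base by blast
  next
    case (step j)
    note g = \<open>adj_auto (Suc j) g\<close>
    have jn: "j < n" using step by simp
    let ?d = "descend (Suc j) g"
    obtain h where h: "adj_auto 1 h" "\<forall>p\<in>TI 1. \<forall>A\<in>TI j. h p \<subseteq> ?d A \<longleftrightarrow> p \<subseteq> A"
      using step.IH[OF adj_auto_descend[OF g jn]] jn by auto
    \<comment> \<open>Inclusion of a point in a \<open>(j + 1)\<close>-space factors through a
      \<open>j\<close>-space, so compatibility with inclusion composes along the descents.\<close>
    have between: "p \<subseteq> B \<longleftrightarrow> (\<exists>A\<in>TI j. p \<subseteq> A \<and> A \<subseteq> B)" if pB: "p \<in> TI 1" "B \<in> TI (Suc j)" for p B
    proof
      assume "p \<subseteq> B"
      then show "\<exists>A\<in>TI j. p \<subseteq> A \<and> A \<subseteq> B"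
        using TI_between[OF pB(1) TI_D(1)[OF pB(2)], of j] step(1) TI_D(3)[OF pB(2)] by (metis le_SucI order_refl)
    qed blast
    have "h p \<subseteq> g B \<longleftrightarrow> p \<subseteq> B" if pB: "p \<in> TI 1" "B \<in> TI (Suc j)" for p B
    proof -
      have im: "?d ` TI j = TI j"
        using adj_auto_descend[OF g jn] by (simp add: adj_auto_def bij_betw_def)
      have "(\<exists>A'\<in>TI j. h p \<subseteq> A' \<and> A' \<subseteq> g B) \<longleftrightarrow> (\<exists>A'\<in>?d ` TI j. h p \<subseteq> A' \<and> A' \<subseteq> g B)"
        unfolding im ..
      also have "\<dots> \<longleftrightarrow> (\<exists>A\<in>TI j. h p \<subseteq> ?d A \<and> ?d A \<subseteq> g B)" by simp
      also have "\<dots> \<longleftrightarrow> (\<exists>A\<in>TI j. p \<subseteq> A \<and> A \<subseteq> B)"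
        using h(2) pB descend_mem(2)[OF g jn] by (intro bex_cong refl) simp
      finally show ?thesis
        using between[OF pB] between[OF adj_auto_mem[OF h(1) pB(1)] adj_auto_mem[OF g pB(2)]] by simp
    qed
    then show ?case using h by blast
  qed
  then obtain h where h: "adj_auto 1 h" "\<forall>p\<in>TI 1. \<forall>B\<in>TI k. h p \<subseteq> g B \<longleftrightarrow> p \<subseteq> B" by blast
  show ?thesis using h by (intro that[of h]) simp_all
qed

section \<open>Extending a permutation of the points\<close>

definition pts :: "'w set \<Rightarrow> 'w set set" where
  "pts U = {p \<in> TI 1. p \<subseteq> U}"

definition ext :: "('w set \<Rightarrow> 'w set) \<Rightarrow> 'w set \<Rightarrow> 'w set" where
  "ext h U = span (\<Union> (h ` pts U))"

lemma point_span:
  assumes "ti U" "x \<in> U" "x \<noteq> 0"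
  shows "span {x} \<in> pts U"
proof -
  have "span {x} \<subseteq> U" using assms by (intro span_minimal) (auto simp: ti_def)
  moreover have "ti (span {x})" using ti_subset[OF assms(1) subspace_span calculation] .
  ultimately show ?thesis using assms(3) by (simp add: pts_def TI_def)
qed

lemma pts_subset_iff:
  assumes "ti U" "subspace V"
  shows "pts U \<subseteq> pts V \<longleftrightarrow> U \<subseteq> V"
proof
  assume p: "pts U \<subseteq> pts V"
  show "U \<subseteq> V"
  proof
    fix x assume x: "x \<in> U"
    show "x \<in> V"
    proof (cases "x = 0")
      case False
      then have "span {x} \<subseteq> V" using point_span[OF assms(1) x] p by (auto simp: pts_def)
      then show ?thesis by (auto intro: span_base)
    qed (simp add: subspace_0 assms)
  qed
qed (auto simp: pts_def)

lemma span_pts: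
  assumes "ti U"
  shows "span (\<Union> (pts U)) = U"
proof
  show "span (\<Union> (pts U)) \<subseteq> U" using assms by (intro span_minimal) (auto simp: pts_def ti_def)
  show "U \<subseteq> span (\<Union> (pts U))"
  proof
    fix x assume x: "x \<in> U"
    show "x \<in> span (\<Union> (pts U))"
    proof (cases "x = 0")
      case False
      then have "span {x} \<in> pts U" "x \<in> span {x}" using point_span[OF assms x] by (auto intro: span_base)
      then have "x \<in> \<Union> (pts U)" by blast
      then show ?thesis by (rule span_base)
    qed (simp add: span_zero)
  qed
qed

lemma adj_points_iff:
  assumes "p \<in> TI 1" "q \<in> TI 1" "1 < n"
  shows "adj 1 p q \<longleftrightarrow> p \<noteq> q \<and> perp p q"
proof -
  have "dim (p \<inter> q) = 0" if "p \<noteq> q"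
    using dim_Int_less[OF TI_D(2)[OF assms(1)] TI_D(2)[OF assms(2)] _ that]
      TI_D(3)[OF assms(1)] TI_D(3)[OF assms(2)] by linarith
  then show ?thesis using assms adj_irrefl[of 1 p] unfolding adj_def by auto
qed

lemma adj_auto_perp:
  assumes h: "adj_auto 1 h" and "1 < n" and pq: "p \<in> TI 1" "q \<in> TI 1"
  shows "perp (h p) (h q) \<longleftrightarrow> perp p q"
proof (cases "p = q")
  case True
  then show ?thesis using TI_D(1)[OF adj_auto_mem[OF h pq(1)]] TI_D(1)[OF pq(1)] by (simp add: ti_def)
next
  case False
  then show ?thesis
    using adj_points_iff[OF pq \<open>1 < n\<close>] adj_auto_eq_iff[OF h pq] h pq
      adj_points_iff[OF adj_auto_mem[OF h pq(1)] adj_auto_mem[OF h pq(2)] \<open>1 < n\<close>]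
    by (simp add: adj_auto_def)
qed

text \<open>Orthogonality of points passes through \<open>h\<close> both ways. Forwards, the images
  of the points of \<open>M\<close> span a totally isotropic space, contained in some maximal
  \<open>N\<close>. Backwards, a point of \<open>N\<close> comes from one orthogonal to all of
  \<open>M\<close>, which lies in \<open>M\<close> by maximality; so \<open>N\<close> has no further
  points.\<close>

lemma adj_auto_maximal:
  assumes h: "adj_auto 1 h" and "1 < n" and M: "M \<in> TI n"
  shows "\<exists>N\<in>TI n. pts N = h ` pts M"
proof -
  let ?S = "h ` pts M"
  have S: "?S \<subseteq> TI 1" using adj_auto_mem[OF h] by (auto simp: pts_def)
  have hp: "perp (h p) (h q) \<longleftrightarrow> perp p q" if "p \<in> TI 1" "q \<in> TI 1" for p q
    using adj_auto_perp[OF h \<open>1 < n\<close> that] .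
  have "perp (h p) (h q)" if "p \<in> pts M" "q \<in> pts M" for p q
    using that hp[of p q] ti_perp[OF TI_D(1)[OF M], of p q] by (simp add: pts_def)
  then have "perp (\<Union> ?S) (\<Union> ?S)" unfolding perp_def by blast
  moreover have "sing x" if "x \<in> \<Union> ?S" for x using that S TI_D(1) unfolding ti_def by blast
  ultimately have "ti (span (\<Union> ?S))" by (intro ti_span_singletons)
  then obtain N where N: "N \<in> TI n" "span (\<Union> ?S) \<subseteq> N" by (rule extend_maximal)
  then have le: "p \<subseteq> N" if "p \<in> ?S" for p using that span_superset[of "\<Union> ?S"] by blast
  have "q \<in> ?S" if q: "q \<in> pts N" for q
  proof -
    have "q \<in> h ` TI 1" using q h by (simp add: pts_def adj_auto_def bij_betw_def)
    then obtain p where p: "p \<in> TI 1" "q = h p" by blast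
    have "perp p r" if "r \<in> pts M" for r
    proof -
      have "h r \<subseteq> N" using le that by blast
      then have "perp q (h r)" using q ti_perp[OF TI_D(1)[OF N(1)]] by (simp add: pts_def)
      then show ?thesis using hp[of p r] p that by (simp add: pts_def)
    qed
    then have "perp p (\<Union> (pts M))" unfolding perp_def by blast
    then have "perp p (span (\<Union> (pts M)))"
      by (rule perp_mono[OF perp_span]) (auto intro: span_base)
    then have "perp M p" using span_pts[OF TI_D(1)[OF M]] perp_sym by simp
    have "p \<subseteq> M"
    proof
      fix x assume x: "x \<in> p"
      have "sing x" using x TI_D(1)[OF p(1)] by (simp add: ti_def)
      moreover have "perp M {x}" using \<open>perp M p\<close> x by (auto simp: perp_def)
      ultimately show "x \<in> M" by (rule maximal_mem[OF M])
    qed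
    then show ?thesis using p by (simp add: pts_def)
  qed
  moreover have "p \<in> pts N" if "p \<in> ?S" for p using le[OF that] that S by (auto simp: pts_def)
  ultimately have "pts N = ?S" by blast
  then show ?thesis using N by blast
qed

lemma pts_eq_INT:
  assumes "ti U"
  shows "pts U = (\<Inter>M\<in>{M \<in> TI n. U \<subseteq> M}. pts M)"
proof
  show "pts U \<subseteq> (\<Inter>M\<in>{M \<in> TI n. U \<subseteq> M}. pts M)" by (auto simp: pts_def)
  obtain M0 where M0: "M0 \<in> TI n" "U \<subseteq> M0" using extend_maximal[OF assms] .
  have U: "U \<in> TI (dim U)" using assms by (simp add: TI_def)
  show "(\<Inter>M\<in>{M \<in> TI n. U \<subseteq> M}. pts M) \<subseteq> pts U"
  proof
    fix p assume p: "p \<in> (\<Inter>M\<in>{M \<in> TI n. U \<subseteq> M}. pts M)"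
    have "p \<subseteq> U"
    proof
      fix x assume x: "x \<in> p"
      show "x \<in> U"
      proof (rule ccontr)
        assume "x \<notin> U"
        then obtain M where "M \<in> TI n" "U \<subseteq> M" "x \<notin> M"
          by (rule TI_avoiding[OF U ti_dim_le[OF assms] order_refl])
        then show False using p x by (auto simp: pts_def)
      qed
    qed
    then show "p \<in> pts U" using p M0 by (auto simp: pts_def)
  qed
qed

lemma ext:
  assumes h: "adj_auto 1 h" and "1 < n" and U: "ti U"
  shows "ti (ext h U)" "pts (ext h U) = h ` pts U"
proof -
  let ?I = "{M \<in> TI n. U \<subseteq> M}"
  obtain M0 where M0: "M0 \<in> ?I" using extend_maximal[OF U] by blast
  have "\<forall>M\<in>?I. \<exists>N\<in>TI n. pts N = h ` pts M" using adj_auto_maximal[OF h \<open>1 < n\<close>] by blast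
  then obtain N where N: "\<And>M. M \<in> ?I \<Longrightarrow> N M \<in> TI n" "\<And>M. M \<in> ?I \<Longrightarrow> pts (N M) = h ` pts M"
    by metis
  \<comment> \<open>The spaces \<open>N M\<close> are the images of the maximal spaces above
    \<open>U\<close>. Taking images commutes with the intersection because \<open>h\<close> is
    injective and the family non-empty, so the points of \<open>V\<close> are the images of those of
    \<open>U\<close>.\<close>
  define V where "V = (\<Inter>M\<in>?I. N M)"
  have "subspace V" unfolding V_def using N(1) TI_D(2) by (intro subspace_Int) blast
  moreover have "V \<subseteq> N M0" using M0 by (auto simp: V_def)
  ultimately have V: "ti V" using ti_subset[of "N M0" V] TI_D(1)[OF N(1)[OF M0]] by blast
  have "inj_on h (TI 1)" using h by (simp add: adj_auto_def bij_betw_def)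
  then have "h ` (\<Inter>M\<in>?I. pts M) = (\<Inter>M\<in>?I. h ` pts M)"
    using M0 by (intro image_INT[where A = ?I and C = "TI 1" and j = M0]) (auto simp: pts_def)
  also have "\<dots> = (\<Inter>M\<in>?I. pts (N M))" using N(2) by (intro INF_cong) auto
  also have "\<dots> = pts V" using M0 by (auto simp: pts_def V_def)
  finally have pV: "pts V = h ` pts U" using pts_eq_INT[OF U] by simp
  have "ext h U = V" using span_pts[OF V] by (simp add: ext_def pV)
  then show "ti (ext h U)" "pts (ext h U) = h ` pts U" using V pV by auto
qed

lemma ext_subset_iff:
  assumes h: "adj_auto 1 h" and "1 < n" and U: "ti U" and V: "ti V"
  shows "ext h U \<subseteq> ext h V \<longleftrightarrow> U \<subseteq> V"
proof -
  have inj: "inj_on h (TI 1)" using h by (simp add: adj_auto_def bij_betw_def)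
  have "ext h U \<subseteq> ext h V \<longleftrightarrow> h ` pts U \<subseteq> h ` pts V"
    using pts_subset_iff[of "ext h U" "ext h V"] ext[OF h \<open>1 < n\<close>] U V by (simp add: ti_def)
  also have "\<dots> \<longleftrightarrow> pts U \<subseteq> pts V"
    using inj_on_image_mem_iff[OF inj, of _ "pts V"] unfolding image_subset_iff
    by (auto simp: pts_def subset_iff)
  also have "\<dots> \<longleftrightarrow> U \<subseteq> V" using U V by (simp add: pts_subset_iff ti_def)
  finally show ?thesis .
qed

lemma ext_eqI:
  assumes "ti V" "pts V = h ` pts U"
  shows "ext h U = V"
  using span_pts[OF assms(1)] by (simp add: ext_def assms(2))

lemma ext_inv:
  assumes h: "adj_auto 1 h" and "1 < n" and U: "ti U"
  shows "ext (inv_into (TI 1) h) (ext h U) = U"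
proof (rule ext_eqI[OF U])
  have "inj_on h (TI 1)" using h by (simp add: adj_auto_def bij_betw_def)
  then show "pts U = inv_into (TI 1) h ` pts (ext h U)"
    unfolding ext(2)[OF assms] by (subst inv_into_image_cancel) (auto simp: pts_def)
qed

lemma ext_inv':
  assumes h: "adj_auto 1 h" and "1 < n" and U: "ti U"
  shows "ext h (ext (inv_into (TI 1) h) U) = U"
proof (rule ext_eqI[OF U])
  have "h ` TI 1 = TI 1" using h by (simp add: adj_auto_def bij_betw_def)
  then show "pts U = h ` pts (ext (inv_into (TI 1) h) U)"
    unfolding ext(2)[OF adj_auto_inv[OF h] \<open>1 < n\<close> U] by (subst image_inv_into_cancel[of _ _ "TI 1"]) (auto simp: pts_def)
qed

text \<open>\<open>h\<close> is not known to come from a semilinear map, so dimension is read as the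
  length of chains: a hyperplane of \<open>U\<close> goes to a proper subspace of
  \<open>ext h U\<close>. The inverse of \<open>h\<close> gives the other inequality in
  \<open>dim_ext\<close>.\<close>

lemma dim_ext_le:
  assumes h: "adj_auto 1 h" and "1 < n" and "ti U"
  shows "dim U \<le> dim (ext h U)"
  using assms(3)
proof (induction "dim U" arbitrary: U)
  case (Suc i)
  obtain W where W: "subspace W" "W \<subseteq> U" "dim W = i"
    by (rule subspace_between[of "{0}" U i]) (use Suc in \<open>auto simp: ti_def subspace_0\<close>)
  have tW: "ti W" using ti_subset[OF Suc.prems W(1,2)] .
  have "\<not> U \<subseteq> W" using W Suc(2) dim_subset[of U W] by auto
  then have "ext h W \<subset> ext h U"
    using ext_subset_iff[OF h \<open>1 < n\<close> tW Suc.prems] ext_subset_iff[OF h \<open>1 < n\<close> Suc.prems tW] W by blast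
  then have "dim (ext h W) < dim (ext h U)"
    using ext(1)[OF h \<open>1 < n\<close>] tW Suc.prems
    by (intro dim_psubset) (simp add: span_eq_iff[THEN iffD2] ti_def)
  moreover have "dim W \<le> dim (ext h W)" using Suc.hyps(1)[of W] W tW by simp
  ultimately show ?case using W Suc.hyps(2) by linarith
next
  case 0
  then show ?case by linarith
qed

lemma dim_ext:
  assumes h: "adj_auto 1 h" and "1 < n" and U: "ti U"
  shows "dim (ext h U) = dim U"
  using dim_ext_le[OF assms] dim_ext_le[OF adj_auto_inv[OF h] \<open>1 < n\<close> ext(1)[OF assms]]
  unfolding ext_inv[OF assms] by (rule antisym[rotated])

section \<open>The isomorphism\<close>

definition objects :: "'w set set" where
  "objects = (\<Union>i\<in>{1..n}. TI i)"

lemma objects_iff: "U \<in> objects \<longleftrightarrow> ti U \<and> 1 \<le> dim U"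
  using ti_dim_le[of U] by (auto simp: objects_def TI_def)

lemma TI_objects: "U \<in> TI i \<Longrightarrow> 1 \<le> i \<Longrightarrow> U \<in> objects"
  by (auto simp: objects_iff TI_def)

lemma subset_iff_incident:
  assumes "subspace U" "subspace V"
  shows "U \<subseteq> V \<longleftrightarrow> incident U V \<and> dim U \<le> dim V"
  using assms dim_subset[of U V] subspace_eqI[of V U] by (auto simp: incident_def)

text \<open>Incidence is symmetrized inclusion, and dimensions decide which way it goes; so for
  dimension-preserving maps inclusion, the easier relation to transport, may replace it.\<close>

definition object_autos :: "('w set \<Rightarrow> 'w set) set" where
  "object_autos = {g \<in> Bij objects. (\<forall>U\<in>objects. dim (g U) = dim U) \<and>
     (\<forall>U\<in>objects. \<forall>V\<in>objects. g U \<subseteq> g V \<longleftrightarrow> U \<subseteq> V)}"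

lemma building_auts_eq:
  assumes "\<And>i. isotropic_spaces scale \<phi> i = TI i"
  shows "building_objects scale \<phi> n = objects" "building_auts scale \<phi> n = object_autos"
proof -
  show o: "building_objects scale \<phi> n = objects"
    by (simp add: building_objects_def objects_def assms)
  have inc: "(\<forall>U\<in>objects. \<forall>V\<in>objects. incident (g U) (g V) \<longleftrightarrow> incident U V) \<longleftrightarrow>
      (\<forall>U\<in>objects. \<forall>V\<in>objects. g U \<subseteq> g V \<longleftrightarrow> U \<subseteq> V)"
    if g: "g \<in> Bij objects" "\<forall>U\<in>objects. dim (g U) = dim U" for g
  proof -
    have "g U \<in> objects" if "U \<in> objects" for U using Bij_imp_funcset[OF g(1)] that by blast
    then have "subspace U" "subspace (g U)" if "U \<in> objects" for U
      using that by (auto simp: objects_iff ti_def)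
    then have e: "g U \<subseteq> g V \<longleftrightarrow> incident (g U) (g V) \<and> dim U \<le> dim V"
      "U \<subseteq> V \<longleftrightarrow> incident U V \<and> dim U \<le> dim V"
      if "U \<in> objects" "V \<in> objects" for U V
      using subset_iff_incident g(2) that by simp_all
    show ?thesis
    proof
      assume inc: "\<forall>U\<in>objects. \<forall>V\<in>objects. incident (g U) (g V) \<longleftrightarrow> incident U V"
      have "g U \<subseteq> g V \<longleftrightarrow> U \<subseteq> V" if UV: "U \<in> objects" "V \<in> objects" for U V
        unfolding e(1)[OF UV] e(2)[OF UV] using inc UV by simp
      then show "\<forall>U\<in>objects. \<forall>V\<in>objects. g U \<subseteq> g V \<longleftrightarrow> U \<subseteq> V" by blast
    qed (simp add: incident_def)
  qed
  show "building_auts scale \<phi> n = object_autos"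
    unfolding building_auts_def object_autos_def o
    by (intro Collect_cong conj_cong refl) (simp add: inc)
qed

lemma object_autos_bij:
  assumes "g \<in> object_autos" "1 \<le> i"
  shows "bij_betw g (TI i) (TI i)"
proof -
  have b: "bij_betw g objects objects" and d: "\<And>U. U \<in> objects \<Longrightarrow> dim (g U) = dim U"
    using assms by (auto simp: object_autos_def Bij_def)
  have TI: "TI i = {U \<in> objects. dim U = i}" using assms(2) by (auto simp: objects_iff TI_def)
  have "g ` TI i = TI i"
  proof
    show "g ` TI i \<subseteq> TI i" using b d by (auto simp: TI bij_betw_def)
    show "TI i \<subseteq> g ` TI i"
    proof
      fix Y assume Y: "Y \<in> TI i"
      then obtain X where X: "X \<in> objects" "Y = g X" using b unfolding TI bij_betw_def by auto
      then have "X \<in> TI i" using d Y by (simp add: TI)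
      then show "Y \<in> g ` TI i" using X by blast
    qed
  qed
  moreover have "inj_on g (TI i)" using b by (auto simp: TI bij_betw_def intro: inj_on_subset)
  ultimately show ?thesis by (simp add: bij_betw_def)
qed

section \<open>Lines of the Grassmannian and restriction to \<open>k\<close>-spaces\<close>

definition lines :: "nat \<Rightarrow> 'w set set set" where
  "lines k = (if k < n
      then {{B \<in> TI k. A \<subseteq> B \<and> B \<subseteq> C} | A C. A \<in> TI (k - 1) \<and> C \<in> TI (k + 1) \<and> A \<subseteq> C}
      else {{B \<in> TI k. A \<subseteq> B} | A. A \<in> TI (k - 1)})"

lemma lines_subset: "L \<in> lines k \<Longrightarrow> L \<subseteq> TI k"
  by (auto simp: lines_def split: if_splits)

text \<open>For dimension reasons the lower space of a joining line can only be
  \<open>B \<inter> C\<close>; an upper space then exists exactly when \<open>B\<close> and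
  \<open>C\<close> are orthogonal.\<close>

lemma adj_iff_line:
  assumes "1 \<le> k" "k \<le> n" "B \<in> TI k" "C \<in> TI k"
  shows "adj k B C \<longleftrightarrow> B \<noteq> C \<and> (\<exists>L\<in>lines k. B \<in> L \<and> C \<in> L)"
proof -
  note s = TI_D(2)[OF assms(3)] TI_D(2)[OF assms(4)]
  have line: "(\<exists>L\<in>lines k. B \<in> L \<and> C \<in> L) \<longleftrightarrow>
     (\<exists>A\<in>TI (k - 1). A \<subseteq> B \<inter> C \<and> (k < n \<longrightarrow> (\<exists>D\<in>TI (k + 1). B \<subseteq> D \<and> C \<subseteq> D)))" (is "_ \<longleftrightarrow> ?r")
  proof (cases "k < n")
    case True
    show ?thesis
    proof
      assume "\<exists>L\<in>lines k. B \<in> L \<and> C \<in> L"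
      then show ?r using True unfolding lines_def by auto
    next
      assume ?r
      then obtain A D where AD: "A \<in> TI (k - 1)" "D \<in> TI (k + 1)" "A \<subseteq> B \<inter> C" "B \<subseteq> D" "C \<subseteq> D"
        using True by blast
      then have "A \<subseteq> D" by blast
      then have "{B \<in> TI k. A \<subseteq> B \<and> B \<subseteq> D} \<in> lines k"
        using True AD unfolding lines_def by auto
      moreover have "B \<in> {B \<in> TI k. A \<subseteq> B \<and> B \<subseteq> D}" "C \<in> {B \<in> TI k. A \<subseteq> B \<and> B \<subseteq> D}"
        using AD assms by auto
      ultimately show "\<exists>L\<in>lines k. B \<in> L \<and> C \<in> L"
        by (intro bexI[of _ "{B \<in> TI k. A \<subseteq> B \<and> B \<subseteq> D}"] conjI)
    qed
  next
    case False
    then show ?thesis using assms(3,4) by (auto simp: lines_def)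
  qed
  have "adj k B C \<longleftrightarrow> B \<noteq> C \<and> ?r"
  proof
    assume a: "adj k B C"
    then have "B \<noteq> C" using adj_irrefl by blast
    have "ti (B \<inter> C)" using assms by (intro ti_Int TI_D)
    then have "B \<inter> C \<in> TI (k - 1)" using a by (auto simp: adj_def TI_def)
    moreover have "\<exists>D\<in>TI (k + 1). B \<subseteq> D \<and> C \<subseteq> D" if "k < n"
      using adj_iff_common[OF that assms(3,4)] a by simp
    ultimately show "B \<noteq> C \<and> ?r" using \<open>B \<noteq> C\<close> by blast
  next
    assume r: "B \<noteq> C \<and> ?r"
    then obtain A where A: "A \<in> TI (k - 1)" "A \<subseteq> B \<inter> C" by blast
    have eq: "B \<inter> C = A"
      using A r TI_D[OF A(1)] assms(1) by (intro Int_hyperplane[OF assms(3,4)]) auto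
    have "perp B C" if "k < n"
    proof -
      obtain D where "D \<in> TI (k + 1)" "B \<subseteq> D" "C \<subseteq> D" using r \<open>k < n\<close> by blast
      then show ?thesis using ti_perp[OF TI_D(1)] by blast
    qed
    then show "adj k B C" using assms TI_D(3)[OF A(1)] by (simp add: adj_def eq)
  qed
  then show ?thesis using line by simp
qed

lemma geometry_auts_adj_auto:
  assumes "1 \<le> k" "k \<le> n" "g \<in> geometry_auts (TI k) (lines k)"
  shows "adj_auto k g"
proof -
  have b: "bij_betw g (TI k) (TI k)" and bl: "bij_betw (\<lambda>L. g ` L) (lines k) (lines k)"
    using assms by (auto simp: geometry_auts_def Bij_def)
  have inj: "inj_on g (TI k)" and mem: "\<And>B. B \<in> TI k \<Longrightarrow> g B \<in> TI k"
    using b by (auto simp: bij_betw_def)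
  have "adj k (g B) (g C) \<longleftrightarrow> adj k B C" if BC: "B \<in> TI k" "C \<in> TI k" for B C
  proof -
    have im: "(\<lambda>L. g ` L) ` lines k = lines k" using bl by (simp add: bij_betw_def)
    have "(\<exists>L\<in>lines k. g B \<in> L \<and> g C \<in> L) \<longleftrightarrow> (\<exists>L\<in>(\<lambda>L. g ` L) ` lines k. g B \<in> L \<and> g C \<in> L)"
      unfolding im ..
    also have "\<dots> \<longleftrightarrow> (\<exists>L\<in>lines k. g B \<in> g ` L \<and> g C \<in> g ` L)" by simp
    also have "\<dots> \<longleftrightarrow> (\<exists>L\<in>lines k. B \<in> L \<and> C \<in> L)"
      using inj_on_image_mem_iff[OF inj _ lines_subset] BC by (intro bex_cong refl) simp
    finally show ?thesis
      using adj_iff_line[OF assms(1,2)] BC mem inj by (simp add: inj_on_eq_iff)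
  qed
  with b show ?thesis by (simp add: adj_auto_def)
qed

lemma restrict_geometry_auts:
  assumes k: "1 \<le> k" "k \<le> n" and g: "g \<in> object_autos"
  shows "restrict g (TI k) \<in> geometry_auts (TI k) (lines k)"
proof -
  let ?g = "restrict g (TI k)"
  have b: "bij_betw g (TI i) (TI i)" if "1 \<le> i" for i using object_autos_bij[OF g that] .
  have bk: "bij_betw ?g (TI k) (TI k)" using b[OF k(1)] by (subst bij_betw_cong) auto
  have sub: "g U \<subseteq> g V \<longleftrightarrow> U \<subseteq> V" if "U \<in> TI i" "V \<in> TI j" "1 \<le> i" "1 \<le> j" for U V i j
    using g TI_objects that by (simp add: object_autos_def)
  have TI0: "TI 0 = {{0}}"
    using ti_0 TI_D(4)[of _ 0] by (auto simp: TI_def dim_eq_0 ti_def subspace_0)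
  \<comment> \<open>For \<open>k = 1\<close> the lower space of a line is \<open>{0}\<close>, which
    is not an object of the building; \<open>g\<close> is \<open>undefined\<close> there, so
    \<open>g'\<close> uses the identity instead.\<close>
  define g' where "g' A = (if k = 1 then A else g A)" for A
  have b': "bij_betw g' (TI (k - 1)) (TI (k - 1))"
  proof (cases "k = 1")
    case True
    then have "g' = id" by (auto simp: g'_def fun_eq_iff)
    then show ?thesis by simp
  next
    case False
    then have "g' = g" by (auto simp: g'_def fun_eq_iff)
    then show ?thesis using b[of "k - 1"] k False by simp
  qed
  have sub': "g' A \<subseteq> g V \<longleftrightarrow> A \<subseteq> V" if "A \<in> TI (k - 1)" "V \<in> TI j" "1 \<le> j" for A V j
  proof (cases "k = 1")
    case True
    then have "A = {0}" using that TI0 by simp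
    moreover have "g V \<in> TI j" using b[OF that(3)] that(2) by (auto simp: bij_betw_def)
    ultimately show ?thesis using TI_D(4)[of "g V" j] TI_D(4)[OF that(2)] True by (simp add: g'_def)
  next
    case False
    then show ?thesis using sub[of A "k - 1" V j] that k by (simp add: g'_def)
  qed
  have im: "?g ` {B \<in> TI k. P B} = {B \<in> TI k. Q B}" if "\<And>B. B \<in> TI k \<Longrightarrow> Q (g B) \<longleftrightarrow> P B" for P Q
  proof -
    have gk: "g ` TI k = TI k" using b[OF k(1)] by (simp add: bij_betw_def)
    have "?g ` {B \<in> TI k. P B} = g ` {B \<in> TI k. P B}" by (intro image_cong) auto
    also have "\<dots> = {B \<in> g ` TI k. Q B}" using that by auto
    finally show ?thesis by (simp add: gk)
  qed
  have surj: "\<exists>X\<in>TI i. g X = Y" if "Y \<in> TI i" "1 \<le> i" for Y i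
    using b[OF that(2)] that(1) unfolding bij_betw_def by (metis imageE)
  have surj': "\<exists>X\<in>TI (k - 1). g' X = Y" if "Y \<in> TI (k - 1)" for Y
    using b' that unfolding bij_betw_def by (metis imageE)
  have mem: "g X \<in> TI i" if "X \<in> TI i" "1 \<le> i" for X i
    using b[OF that(2)] that(1) unfolding bij_betw_def by blast
  have mem': "g' X \<in> TI (k - 1)" if "X \<in> TI (k - 1)" for X
    using b' that unfolding bij_betw_def by blast
  have "(\<lambda>L. ?g ` L) ` lines k = lines k"
  proof (cases "k < n")
    case True
    let ?L = "\<lambda>A C. {B \<in> TI k. A \<subseteq> B \<and> B \<subseteq> C}"
    have imL: "?g ` ?L A C = ?L (g' A) (g C)" if "A \<in> TI (k - 1)" "C \<in> TI (k + 1)" for A C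
      using that k by (intro im) (simp add: sub'[where j = k] sub[where i = k and j = "k + 1"])
    have ln: "L \<in> lines k \<longleftrightarrow> (\<exists>A C. L = ?L A C \<and> A \<in> TI (k - 1) \<and> C \<in> TI (k + 1) \<and> A \<subseteq> C)" for L
      using True by (simp add: lines_def)
    have sC: "g' A \<subseteq> g C \<longleftrightarrow> A \<subseteq> C" if "A \<in> TI (k - 1)" "C \<in> TI (k + 1)" for A C
      using sub'[OF that] by simp
    have "?g ` L \<in> lines k" if "L \<in> lines k" for L
    proof -
      obtain A C where AC: "L = ?L A C" "A \<in> TI (k - 1)" "C \<in> TI (k + 1)" "A \<subseteq> C"
        using \<open>L \<in> lines k\<close> unfolding ln by blast
      have "?g ` L = ?L (g' A) (g C)" unfolding AC(1) by (rule imL[OF AC(2,3)])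
      moreover have "g' A \<in> TI (k - 1)" "g C \<in> TI (k + 1)" "g' A \<subseteq> g C"
        using AC mem' mem[of C "k + 1"] sC by auto
      ultimately show ?thesis unfolding ln by blast
    qed
    moreover have "\<exists>L'\<in>lines k. L = ?g ` L'" if "L \<in> lines k" for L
    proof -
      obtain A C where AC: "L = ?L A C" "A \<in> TI (k - 1)" "C \<in> TI (k + 1)" "A \<subseteq> C"
        using \<open>L \<in> lines k\<close> unfolding ln by blast
      obtain A' where A': "A' \<in> TI (k - 1)" "g' A' = A" using surj'[OF AC(2)] by blast
      obtain C' where C': "C' \<in> TI (k + 1)" "g C' = C" using surj[OF AC(3)] by auto
      have "A' \<subseteq> C'" using sC[OF A'(1) C'(1)] A' C' AC by simp
      then have "?L A' C' \<in> lines k" unfolding ln using A' C' by blast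
      moreover have "L = ?g ` ?L A' C'" using imL[OF A'(1) C'(1)] A' C' AC(1) by simp
      ultimately show ?thesis by blast
    qed
    ultimately show ?thesis by blast
  next
    case False
    let ?L = "\<lambda>A. {B \<in> TI k. A \<subseteq> B}"
    have imL: "?g ` ?L A = ?L (g' A)" if "A \<in> TI (k - 1)" for A
      using that k by (intro im) (simp add: sub'[where j = k])
    have ln: "L \<in> lines k \<longleftrightarrow> (\<exists>A. L = ?L A \<and> A \<in> TI (k - 1))" for L
      using False by (simp add: lines_def)
    have "?g ` L \<in> lines k" if "L \<in> lines k" for L
    proof -
      obtain A where A: "L = ?L A" "A \<in> TI (k - 1)" using \<open>L \<in> lines k\<close> unfolding ln by blast
      have "?g ` L = ?L (g' A)" unfolding A(1) by (rule imL[OF A(2)])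
      then show ?thesis unfolding ln using mem'[OF A(2)] by blast
    qed
    moreover have "\<exists>L'\<in>lines k. L = ?g ` L'" if "L \<in> lines k" for L
    proof -
      obtain A where A: "L = ?L A" "A \<in> TI (k - 1)" using \<open>L \<in> lines k\<close> unfolding ln by blast
      obtain A' where A': "A' \<in> TI (k - 1)" "g' A' = A" using surj'[OF A(2)] by blast
      have "L = ?g ` ?L A'" using imL[OF A'(1)] A' A(1) by simp
      moreover have "?L A' \<in> lines k" unfolding ln using A' by blast
      ultimately show ?thesis by blast
    qed
    ultimately show ?thesis by blast
  qed
  moreover have "inj_on (\<lambda>L. ?g ` L) (lines k)"
    using bk lines_subset unfolding inj_on_def bij_betw_def by (metis inj_on_def inj_on_image_eq_iff)
  ultimately have "bij_betw (\<lambda>L. ?g ` L) (lines k) (lines k)" by (simp add: bij_betw_def)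
  moreover have "?g \<in> Bij (TI k)" using bk by (simp add: Bij_def)
  ultimately show ?thesis unfolding geometry_auts_def by blast
qed

text \<open>An object of dimension at most \<open>k\<close> is the intersection of the
  \<open>k\<close>-spaces above it, a larger one is the union of the \<open>k\<close>-spaces inside
  it; so images of \<open>k\<close>-spaces determine all images. This is the injectivity of
  restriction.\<close>

lemma object_autos_eqI:
  assumes k: "1 \<le> k" "k \<le> n" and gh: "g \<in> object_autos" "h \<in> object_autos"
    and eq: "\<And>X. X \<in> TI k \<Longrightarrow> g X = h X"
  shows "g = h"
proof (rule extensionalityI[of _ objects])
  show "g \<in> extensional objects" "h \<in> extensional objects"
    using gh by (auto simp: object_autos_def Bij_def)
  fix U assume U: "U \<in> objects"
  have mem: "f V \<in> objects" if "f \<in> object_autos" "V \<in> objects" for f V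
    using that Bij_imp_funcset[of f objects] by (auto simp: object_autos_def)
  have dims: "dim (f V) = dim V" if "f \<in> object_autos" "V \<in> objects" for f V
    using that by (simp add: object_autos_def)
  have sub: "f V \<subseteq> f W \<longleftrightarrow> V \<subseteq> W" if "f \<in> object_autos" "V \<in> objects" "W \<in> objects" for f V W
    using that by (simp add: object_autos_def)
  have surj: "\<exists>X\<in>TI k. g X = B" if "B \<in> TI k" for B
    using object_autos_bij[OF gh(1) k(1)] that unfolding bij_betw_def by (metis imageE)
  have ob: "X \<in> objects" if "X \<in> TI k" for X using TI_objects[OF that k(1)] .
  have ti: "ti (g U)" "ti (h U)" and d: "dim (g U) = dim U" "dim (h U) = dim U"
    using mem gh U dims by (auto simp: objects_iff)
  have s: "subspace (g U)" "subspace (h U)" using ti by (auto simp: ti_def)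
  show "g U = h U"
  proof (cases "dim U \<le> k")
    case True
    have gT: "g U \<in> TI (dim U)" using ti d by (simp add: TI_def)
    have "h U \<subseteq> g U"
    proof
      fix p assume p: "p \<in> h U"
      show "p \<in> g U"
      proof (rule ccontr)
        assume "p \<notin> g U"
        then obtain B where B: "B \<in> TI k" "g U \<subseteq> B" "p \<notin> B"
          by (rule TI_avoiding[OF gT True k(2)])
        obtain X where X: "X \<in> TI k" "g X = B" using surj[OF B(1)] by blast
        have "U \<subseteq> X" using sub[OF gh(1) U ob[OF X(1)]] X B by simp
        then have "h U \<subseteq> h X" using sub[OF gh(2) U ob[OF X(1)]] by simp
        then show False using eq[OF X(1)] X B p by blast
      qed
    qed
    then show ?thesis using subspace_eqI[OF s(2,1)] d by simp
  next
    case False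
    have "g U \<subseteq> h U"
    proof
      fix v assume v: "v \<in> g U"
      have sv: "span {v} \<subseteq> g U" using v s by (intro span_minimal) auto
      then have "ti (span {v})" using ti_subset[OF ti(1)] by blast
      then have "span {v} \<in> TI (dim (span {v}))" by (simp add: TI_def)
      moreover have "dim (span {v}) \<le> k" using k by simp
      moreover have "k \<le> dim (g U)" using False d by simp
      ultimately obtain B where B: "B \<in> TI k" "span {v} \<subseteq> B" "B \<subseteq> g U"
        using TI_between[OF _ ti(1) sv] by blast
      obtain X where X: "X \<in> TI k" "g X = B" using surj[OF B(1)] by blast
      have "X \<subseteq> U" using sub[OF gh(1) ob[OF X(1)] U] X B by simp
      then have "h X \<subseteq> h U" using sub[OF gh(2) ob[OF X(1)] U] by simp
      then show "v \<in> h U" using eq[OF X(1)] X B span_base[of v "{v}"] by blast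
    qed
    then show ?thesis using subspace_eqI[OF s] d by simp
  qed
qed

lemma ext_object_autos:
  assumes h: "adj_auto 1 h" and "1 < n"
  shows "restrict (ext h) objects \<in> object_autos"
proof -
  have mem: "ext f U \<in> objects" if "adj_auto 1 f" "U \<in> objects" for f U
    using ext(1)[OF that(1) \<open>1 < n\<close>] dim_ext[OF that(1) \<open>1 < n\<close>] that(2) by (simp add: objects_iff)
  have ti: "ti U" if "U \<in> objects" for U using that by (simp add: objects_iff)
  have "bij_betw (ext h) objects objects"
    by (rule bij_betwI[of _ _ _ "ext (inv_into (TI 1) h)"])
      (use mem[OF h] mem[OF adj_auto_inv[OF h]] ext_inv[OF assms] ext_inv'[OF assms] ti in auto)
  then have "restrict (ext h) objects \<in> Bij objects" by (simp add: Bij_def bij_betw_restrict_eq)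
  then show ?thesis
    using dim_ext[OF assms] ext_subset_iff[OF assms] ti by (simp add: object_autos_def)
qed

text \<open>The points of \<open>g B\<close> are exactly the images under \<open>h\<close> of the
  points of \<open>B\<close>, so the extension of \<open>h\<close> agrees with \<open>g\<close> on
  \<open>k\<close>-spaces. This is the surjectivity of restriction.\<close>

lemma geometry_auts_extend:
  assumes k: "1 \<le> k" "k \<le> n" and "1 < n" and g: "g \<in> geometry_auts (TI k) (lines k)"
  shows "\<exists>f\<in>object_autos. restrict f (TI k) = g"
proof -
  have ga: "adj_auto k g" using geometry_auts_adj_auto[OF k g] .
  obtain h where h: "adj_auto 1 h" "\<And>p B. p \<in> TI 1 \<Longrightarrow> B \<in> TI k \<Longrightarrow> h p \<subseteq> g B \<longleftrightarrow> p \<subseteq> B"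
    using adj_auto_points[OF ga k] by blast
  have h1: "h ` TI 1 = TI 1" using h(1) by (simp add: adj_auto_def bij_betw_def)
  have "ext h B = g B" if B: "B \<in> TI k" for B
  proof (rule ext_eqI[OF TI_D(1)[OF adj_auto_mem[OF ga B]]])
    have "pts (g B) = {q \<in> h ` TI 1. q \<subseteq> g B}" unfolding pts_def h1 ..
    also have "\<dots> = h ` {p \<in> TI 1. h p \<subseteq> g B}" by auto
    also have "{p \<in> TI 1. h p \<subseteq> g B} = pts B" using h(2)[OF _ B] by (auto simp: pts_def)
    finally show "pts (g B) = h ` pts B" .
  qed
  moreover have "TI k \<subseteq> objects" using TI_objects k by blast
  ultimately have eq: "restrict (restrict (ext h) objects) (TI k) B = g B" if "B \<in> TI k" for B
    using that by auto
  have "g \<in> extensional (TI k)" using g by (auto simp: geometry_auts_def Bij_def)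
  then have "restrict (restrict (ext h) objects) (TI k) = g"
    by (intro extensionalityI[of _ "TI k"] eq) auto
  then show ?thesis using ext_object_autos[OF h(1) \<open>1 < n\<close>] by blast
qed

text \<open>The isomorphism is restriction to the \<open>k\<close>-spaces, which runs from the
  building to the Grassmannian; the stated direction is its inverse.\<close>

lemma Aut_grassmannian_iso:
  assumes k: "1 \<le> k" "k \<le> n" and "1 < n" and TI: "\<And>i. isotropic_spaces scale \<phi> i = TI i"
  shows "Aut_grassmannian scale \<phi> n k \<cong> Aut_building scale \<phi> n"
proof -
  note b = building_auts_eq[OF TI]
  have l: "grassmannian_lines scale \<phi> n k = lines k" by (simp add: grassmannian_lines_def lines_def TI)
  let ?G = "Aut_building scale \<phi> n" and ?H = "Aut_grassmannian scale \<phi> n k"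
  have car: "carrier ?G = object_autos" "carrier ?H = geometry_auts (TI k) (lines k)"
    by (simp_all add: Aut_building_def Aut_grassmannian_def b l TI)
  have BG: "g \<in> Bij objects" if "g \<in> object_autos" for g using that by (simp add: object_autos_def)
  have BH: "g \<in> Bij (TI k)" if "g \<in> geometry_auts (TI k) (lines k)" for g
    using that by (simp add: geometry_auts_def)
  have "restrict (compose objects f g) (TI k) = compose (TI k) (restrict f (TI k)) (restrict g (TI k))"
    if "f \<in> object_autos" "g \<in> object_autos" for f g
  proof -
    have "g X \<in> TI k" "X \<in> objects" if "X \<in> TI k" for X
      using object_autos_bij[OF \<open>g \<in> object_autos\<close> k(1)] TI_objects[OF that k(1)] that
      by (auto simp: bij_betw_def)
    then show ?thesis by (auto simp: compose_def fun_eq_iff)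
  qed
  moreover have "f \<otimes>\<^bsub>?G\<^esub> g = compose objects f g" if "f \<in> object_autos" "g \<in> object_autos" for f g
    using that BG by (simp add: Aut_building_def BijGroup_def b)
  moreover have "f \<otimes>\<^bsub>?H\<^esub> g = compose (TI k) f g"
    if "f \<in> geometry_auts (TI k) (lines k)" "g \<in> geometry_auts (TI k) (lines k)" for f g
    using that BH by (simp add: Aut_grassmannian_def BijGroup_def TI)
  ultimately have "(\<lambda>g. restrict g (TI k)) \<in> hom ?G ?H"
    using restrict_geometry_auts[OF k] by (simp add: hom_def car)
  moreover have "inj_on (\<lambda>g. restrict g (TI k)) object_autos"
  proof (rule inj_onI)
    fix g h assume gh: "g \<in> object_autos" "h \<in> object_autos" "restrict g (TI k) = restrict h (TI k)"
    then have "g X = h X" if "X \<in> TI k" for X using that by (metis restrict_apply')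
    then show "g = h" using object_autos_eqI[OF k gh(1,2)] by blast
  qed
  moreover have "(\<lambda>g. restrict g (TI k)) ` object_autos = geometry_auts (TI k) (lines k)"
    using restrict_geometry_auts[OF k] geometry_auts_extend[OF k \<open>1 < n\<close>] by blast
  ultimately have "(\<lambda>g. restrict g (TI k)) \<in> iso ?G ?H"
    by (simp add: iso_def bij_betw_def car)
  then have "?G \<cong> ?H" by (rule is_isoI)
  then show ?thesis by (rule group.iso_sym[OF group_Aut_building])
qed

end

section \<open>The classical polar spaces\<close>

lemma associated_bilinear_commute: "associated_bilinear q x y = associated_bilinear q y x"
  unfolding associated_bilinear_def add.commute[of y x] by (rule diff_right_commute)

lemma quadratic_orthogonality:
  assumes fd: "finite_dimensional_vector_space scale Basis" and q: "quadratic_form scale q"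
  defines "orth \<equiv> \<lambda>x y. associated_bilinear q x y = 0" and "sing \<equiv> \<lambda>x. q x = 0"
  shows "orthogonality scale Basis orth sing"
    and "isotropic_spaces scale (Quadratic q) i = orthogonality.TI scale orth sing i"
proof -
  interpret finite_dimensional_vector_space scale Basis by fact
  let ?f = "associated_bilinear q"
  have f_add: "?f x (y + z) = ?f x y + ?f x z" and f_scale: "?f x (scale c y) = c * ?f x y"
    and q_scale: "q (scale c x) = c\<^sup>2 * q x" for x y z c
    using q by (auto simp: quadratic_form_def sesquilinear_def)
  have f_0: "?f x 0 = 0" for x using f_scale[of x 0 0] by simp
  have f_diff: "?f x (y - z) = ?f x y - ?f x z" for x y z
    using f_add[of x "y - z" z] by (simp add: algebra_simps)
  have q_add: "q (x + y) = q x + q y + ?f x y" for x y by (simp add: associated_bilinear_def)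
  show o: "orthogonality scale Basis orth sing"
  proof unfold_locales
    show "orth y x" if "orth x y" for x y
      using that by (simp add: orth_def associated_bilinear_commute[of q y x])
    show "subspace {y. orth x y}" for x
      by (rule subspaceI) (auto simp: orth_def f_0 f_add f_scale)
    show "\<exists>c. orth x (z - scale c y)" if "\<not> orth x y" for x y z
      using that by (intro exI[of _ "?f x z / ?f x y"]) (simp add: orth_def f_diff f_scale)
    show "sing 0" using q_scale[of 0 0] by (simp add: sing_def)
    show "sing (scale c x)" if "sing x" for c x using that by (simp add: sing_def q_scale)
    show "sing (x + y)" if "sing x" "sing y" "orth x y" for x y
      using that by (simp add: sing_def orth_def q_add)
    show "orth x x" if "sing x" for x
    proof -
      \<comment> \<open>The value at \<open>(x, x)\<close> is \<open>q (x + x) - q x - q x\<close>,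
        and a multiple of a singular vector is singular, in every characteristic.\<close>
      have "x + x = scale (1 + 1) x" by (simp only: scale_left_distrib scale_one)
      then show ?thesis using that by (simp add: sing_def orth_def associated_bilinear_def q_scale)
    qed
  qed
  interpret orthogonality scale Basis orth sing by (rule o)
  \<comment> \<open>Total singularity already implies orthogonality: \<open>x + y\<close> lies in
    \<open>U\<close> as well, and the bilinear form is a difference of values of
    \<open>q\<close>.\<close>
  have "totally_isotropic (Quadratic q) U \<longleftrightarrow> (\<forall>x\<in>U. sing x) \<and> perp U U" if "subspace U" for U
    using subspace_add[OF that]
    unfolding perp_def by (auto simp: sing_def orth_def associated_bilinear_def)
  then show "isotropic_spaces scale (Quadratic q) i = TI i"
    by (auto simp: isotropic_spaces_def TI_def ti_def)
qed

text \<open>Thickness rests on \<open>2 * n < dim\<close>, which leaves room for a vector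
  \<open>v\<close> orthogonal to \<open>A\<close>, \<open>e\<close> and \<open>f\<close> but outside
  \<open>A\<close>. In dimension \<open>2 * n\<close>, the hyperbolic quadric, only two maximal
  spaces pass through \<open>A\<close>.\<close>

lemma quadratic_polar_space:
  assumes fd: "finite_dimensional_vector_space scale Basis" and q: "quadratic_form scale q"
    and nondeg: "nondegenerate_quadratic q"
    and n: "1 \<le> n" "2 * n < vector_space.dim scale UNIV"
    and witt: "isotropic_spaces scale (Quadratic q) n \<noteq> {}"
      "\<And>i. isotropic_spaces scale (Quadratic q) i \<noteq> {} \<Longrightarrow> i \<le> n"
  shows "polar_space scale Basis (\<lambda>x y. associated_bilinear q x y = 0) (\<lambda>x. q x = 0) n"
proof -
  let ?f = "associated_bilinear q"
  define orth where "orth x y \<longleftrightarrow> ?f x y = 0" for x y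
  define sing where "sing x \<longleftrightarrow> q x = 0" for x
  note o = quadratic_orthogonality[OF fd q, folded orth_def sing_def]
  interpret orthogonality scale Basis orth sing by (rule o(1))
  have f_add: "?f x (y + z) = ?f x y + ?f x z" and f_scale: "?f x (scale c y) = c * ?f x y"
    and q_scale: "q (scale c x) = c\<^sup>2 * q x" for x y z c
    using q by (auto simp: quadratic_form_def sesquilinear_def)
  note f_sym = associated_bilinear_commute[of q]
  have q_add: "q (x + y) = q x + q y + ?f x y" for x y by (simp add: associated_bilinear_def)
  have "polar_space scale Basis orth sing n"
  proof
    show "TI n \<noteq> {}" "TI i \<noteq> {} \<Longrightarrow> i \<le> n" for i using witt o(2) by auto
    show "\<exists>y. sing y \<and> \<not> orth x y" if x: "sing x" "x \<noteq> 0" for x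
    proof -
      obtain y where y: "?f x y \<noteq> 0"
        using nondeg x by (auto simp: nondegenerate_quadratic_def sing_def)
      \<comment> \<open>Chosen to solve \<open>q y + c * ?f x y = 0\<close>, the left side being the
        value of \<open>q\<close> at \<open>y + scale c x\<close>. Adding multiples of
        \<open>x\<close> leaves the pairing with \<open>x\<close> unchanged.\<close>
      define c where "c = - q y / ?f x y"
      have "c * ?f x y = - q y" using y by (simp add: c_def)
      then have "q (y + scale c x) = 0"
        using x f_sym[of y x] by (simp add: q_add q_scale f_scale sing_def)
      moreover have "?f x (y + scale c x) \<noteq> 0"
        using y sing_orth[OF x(1)] by (simp add: f_add f_scale orth_def)
      ultimately show ?thesis unfolding sing_def orth_def by blast
    qed
    fix A e f
    assume A: "A \<in> TI (n - 1)" and ef: "sing e" "sing f" "perp A {e, f}" "\<not> orth e f"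
    let ?X = "insert e (insert f A)"
    \<comment> \<open>At most \<open>n + 1\<close> conditions in dimension at least
      \<open>2 * n + 1\<close> leave \<open>n\<close> dimensions, one more than \<open>A\<close>
      has.\<close>
    have "dim ?X \<le> Suc (Suc (dim A))" by (simp add: dim_insert)
    moreover have "dim UNIV \<le> dim {y. \<forall>x\<in>?X. orth x y} + dim ?X"
      using dim_Int_perp[OF subspace_UNIV, of ?X] unfolding Int_UNIV_left .
    ultimately have "n \<le> dim {y. \<forall>x\<in>?X. orth x y}"
      using n TI_D(3)[OF A] by linarith
    then have "\<not> {y. \<forall>x\<in>?X. orth x y} \<subseteq> A"
      using dim_subset[of "{y. \<forall>x\<in>?X. orth x y}" A] n(1) TI_D(3)[OF A] by linarith
    then obtain v where v: "\<forall>x\<in>?X. orth x v" "v \<notin> A" by blast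
    have A_perp: "perp A {x, y}" if "\<And>a. a \<in> A \<Longrightarrow> orth a x" "\<And>a. a \<in> A \<Longrightarrow> orth a y" for x y
      using that by (auto simp: perp_def)
    \<comment> \<open>A singular \<open>v\<close> would extend the \<open>n\<close>-space spanned by
      \<open>A\<close> and \<open>e\<close>, which does not contain it, to a totally isotropic space
      of dimension \<open>n + 1\<close>.\<close>
    have "q v \<noteq> 0"
    proof
      assume "q v = 0"
      have nA: "e \<notin> A" using ef orth_sym by (auto simp: perp_def dest: orth_sym)
      have E: "span (insert e A) \<in> TI (Suc (n - 1))"
        using ef nA by (intro TI_insert[OF A]) (auto simp: perp_def)
      have "v \<notin> span (insert e A)"
      proof
        assume "v \<in> span (insert e A)"
        then obtain c where c: "v - scale c e \<in> A"
          using TI_D(2)[OF A] by (auto simp: span_breakdown_eq span_eq_iff[THEN iffD2])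
        then have "orth f (v - scale c e)" using ef orth_sym by (auto simp: perp_def)
        then have "orth f (scale c e)" using v orth_diff[of f v "v - scale c e"] by simp
        then have "c = 0" using ef(4) f_sym by (auto simp: orth_def f_scale)
        then show False using c v by simp
      qed
      moreover have "perp (insert e A) {v}" using v by (auto simp: perp_def)
      then have "perp (span (insert e A)) {v}"
        by (rule perp_mono[OF perp_span]) (auto intro: span_base)
      ultimately have "span (insert v (span (insert e A))) \<in> TI (Suc (Suc (n - 1)))"
        using \<open>q v = 0\<close> by (intro TI_insert[OF E]) (auto simp: sing_def)
      then have "Suc (Suc (n - 1)) \<le> n" using witt(2) o(2) by blast
      then show False by simp
    qed
    have efn: "?f e f \<noteq> 0" "?f f e \<noteq> 0" and z: "q e = 0" "q f = 0" "?f e v = 0" "?f f v = 0"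
      using ef v f_sym[of e f] by (auto simp: sing_def orth_def)
    have ee: "?f e e = 0" "?f f f = 0" using ef sing_orth by (auto simp: orth_def)
    \<comment> \<open>The value of \<open>q\<close> at \<open>e + (scale c f + v)\<close> is
      \<open>c * ?f e f + q v\<close>, which this \<open>c\<close> makes zero. It is non-zero
      because \<open>v\<close> is not singular, and that keeps the sum non-orthogonal to
      \<open>e\<close>.\<close>
    define c where "c = - q v / ?f e f"
    have c: "c * ?f e f = - q v" "c \<noteq> 0" using efn \<open>q v \<noteq> 0\<close> by (simp_all add: c_def)
    let ?g = "e + (scale c f + v)"
    have "q ?g = 0" using z c(1) f_sym[of f v] by (simp add: q_add q_scale f_add f_scale f_sym[of "scale c f" v])
    moreover have "\<not> orth e ?g" "\<not> orth f ?g"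
      using z efn ee c(2) by (auto simp: orth_def f_add f_scale)
    moreover have "perp A {?g}"
      using ef v unfolding perp_def by (auto intro!: orth_add orth_scale)
    ultimately show "\<exists>g. sing g \<and> perp A {g} \<and> \<not> orth e g \<and> \<not> orth f g"
      unfolding sing_def by blast
  qed
  then show ?thesis unfolding orth_def sing_def .
qed

section \<open>Alternating and hermitian forms\<close>

lemma sesquilinear_orthogonality:
  assumes fd: "finite_dimensional_vector_space scale Basis"
    and s: "sesquilinear scale \<sigma> h" and \<sigma>: "field_automorphism \<sigma>"
    and refl: "\<forall>x y. h x y = 0 \<longrightarrow> h y x = 0"
  defines "orth \<equiv> \<lambda>x y. h x y = 0" and "sing \<equiv> \<lambda>x. h x x = 0"
  shows "orthogonality scale Basis orth sing"
    and "isotropic_spaces scale (Sesquilinear h) i = orthogonality.TI scale orth sing i"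
proof -
  interpret finite_dimensional_vector_space scale Basis by fact
  have h_add: "h x (y + z) = h x y + h x z" and h_scale: "h x (scale c y) = \<sigma> c * h x y"
    and h_add': "h (x + y) z = h x z + h y z" and h_scale': "h (scale c x) y = c * h x y" for x y z c
    using s by (auto simp: sesquilinear_def)
  have h_diff: "h x (y - z) = h x y - h x z" for x y z
    using h_add[of x "y - z" z] by (simp add: algebra_simps)
  have h_0: "h x 0 = 0" for x using h_diff[of x 0 0] by simp
  show o: "orthogonality scale Basis orth sing"
  proof unfold_locales
    show "orth y x" if "orth x y" for x y using that refl by (simp add: orth_def)
    show "subspace {y. orth x y}" for x
      by (rule subspaceI) (auto simp: orth_def h_0 h_add h_scale)
    show "\<exists>c. orth x (z - scale c y)" if "\<not> orth x y" for x y z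
    proof -
      \<comment> \<open>The form is \<open>\<sigma>\<close>-semilinear in its second argument, so
        the coefficient has to be pulled back through \<open>\<sigma>\<close>.\<close>
      obtain c where "\<sigma> c = h x z / h x y"
        using \<sigma> unfolding field_automorphism_def bij_def by (metis surjD)
      then show ?thesis using that by (intro exI[of _ c]) (simp add: orth_def h_diff h_scale)
    qed
    show "sing 0" by (simp add: sing_def h_0)
    show "sing (scale c x)" if "sing x" for c x using that by (simp add: sing_def h_scale h_scale')
    show "sing (x + y)" if "sing x" "sing y" "orth x y" for x y
      using that refl by (simp add: sing_def orth_def h_add h_add')
    show "orth x x" if "sing x" for x using that by (simp add: sing_def orth_def)
  qed
  interpret orthogonality scale Basis orth sing by (rule o)
  show "isotropic_spaces scale (Sesquilinear h) i = TI i"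
    unfolding isotropic_spaces_def TI_def ti_def perp_def totally_isotropic.simps
    by (auto simp: orth_def sing_def)
qed

lemma alternating_polar_space:
  assumes fd: "finite_dimensional_vector_space scale Basis" and f: "alternating_form scale f"
    and nondeg: "nondegenerate f"
    and witt: "isotropic_spaces scale (Sesquilinear f) n \<noteq> {}"
      "\<And>i. isotropic_spaces scale (Sesquilinear f) i \<noteq> {} \<Longrightarrow> i \<le> n"
  shows "polar_space scale Basis (\<lambda>x y. f x y = 0) (\<lambda>x. f x x = 0) n"
    and "isotropic_spaces scale (Sesquilinear f) i =
      orthogonality.TI scale (\<lambda>x y. f x y = 0) (\<lambda>x. f x x = 0) i"
proof -
  have s: "sesquilinear scale id f" and alt: "\<And>x. f x x = 0"
    using f by (auto simp: alternating_form_def)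
  have f_add: "f x (y + z) = f x y + f x z" and f_add': "f (x + y) z = f x z + f y z" for x y z
    using s by (auto simp: sesquilinear_def)
  have f_neg: "f y x = - f x y" for x y
  proof -
    have "f (x + y) (x + y) = f y x + f x y" by (simp only: f_add f_add') (simp add: alt)
    then show ?thesis by (simp add: alt eq_neg_iff_add_eq_0)
  qed
  have id: "field_automorphism (id :: 'a \<Rightarrow> 'a)" by (simp add: field_automorphism_def)
  define orth where "orth x y \<longleftrightarrow> f x y = 0" for x y
  define sing where "sing x \<longleftrightarrow> f x x = 0" for x
  have refl: "\<forall>x y. f x y = 0 \<longrightarrow> f y x = 0" using f_neg by (metis minus_zero)
  note o = sesquilinear_orthogonality[OF fd s id refl, folded sing_def, folded orth_def]
  interpret orthogonality scale Basis orth sing by (rule o(1))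
  have sing: "sing x" for x by (simp add: sing_def alt)
  have "polar_space scale Basis orth sing n"
  proof
    show "TI n \<noteq> {}" "TI i \<noteq> {} \<Longrightarrow> i \<le> n" for i using witt o(2) by auto
    show "\<exists>y. sing y \<and> \<not> orth x y" if "x \<noteq> 0" for x
      using nondeg that sing by (auto simp: nondegenerate_def orth_def)
    fix A e f'
    assume "perp A {e, f'}" "\<not> orth e f'"
    \<comment> \<open>For an alternating form every vector is singular, so the plain sum of
      \<open>e\<close> and \<open>f'\<close> serves as the third vector.\<close>
    then have "perp A {e + f'}" "\<not> orth e (e + f')" "\<not> orth f' (e + f')"
      using f_neg[of e f'] by (auto simp: orth_def perp_def f_add alt)
    then show "\<exists>g. sing g \<and> perp A {g} \<and> \<not> orth e g \<and> \<not> orth f' g" using sing by blast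
  qed
  then show "polar_space scale Basis (\<lambda>x y. f x y = 0) (\<lambda>x. f x x = 0) n"
    unfolding orth_def sing_def .
  show "isotropic_spaces scale (Sesquilinear f) i =
      orthogonality.TI scale (\<lambda>x y. f x y = 0) (\<lambda>x. f x x = 0) i"
    using o(2) unfolding orth_def sing_def .
qed

text \<open>If all traces vanished, \<open>t = 1\<close> would give characteristic 2, hence
  \<open>\<sigma> t = - t = t\<close> for all \<open>t\<close>. A non-zero trace is fixed by
  \<open>\<sigma>\<close>, so dividing by it normalizes it to 1. The element \<open>u\<close>
  replaces one half, which does not exist in characteristic 2.\<close>

lemma trace_one:
  fixes \<sigma> :: "'f::field \<Rightarrow> 'f"
  assumes "involutory_automorphism \<sigma>"
  shows "\<exists>u. u + \<sigma> u = 1"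
proof -
  have add: "\<sigma> (a + b) = \<sigma> a + \<sigma> b" and mult: "\<sigma> (a * b) = \<sigma> a * \<sigma> b"
    and one: "\<sigma> 1 = 1" and invol: "\<sigma> (\<sigma> a) = a" for a b
    using assms by (auto simp: involutory_automorphism_def field_automorphism_def fun_eq_iff)
  have "\<exists>t. t + \<sigma> t \<noteq> 0"
  proof (rule ccontr)
    assume "\<nexists>t. t + \<sigma> t \<noteq> 0"
    then have *: "t + \<sigma> t = 0" for t by blast
    have "\<sigma> t = t" for t
    proof -
      have "t + t = t * (1 + \<sigma> 1)" by (simp add: one distrib_left)
      then have "t + t = t + \<sigma> t" using *[of 1] *[of t] by simp
      then show ?thesis by simp
    qed
    then show False using assms by (auto simp: involutory_automorphism_def fun_eq_iff)
  qed
  then obtain t where t: "t + \<sigma> t \<noteq> 0" by blast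
  let ?s = "t + \<sigma> t"
  have s: "\<sigma> ?s = ?s" by (simp add: add invol add.commute)
  have "\<sigma> (t / ?s) * ?s = \<sigma> t" using mult[of "t / ?s" ?s] t s by simp
  then have "(t / ?s + \<sigma> (t / ?s)) * ?s = ?s" using t by (simp add: distrib_right)
  then show ?thesis using t by (metis mult_cancel_right1)
qed

lemma hermitian_polar_space:
  fixes scale :: "'f::field \<Rightarrow> 'w::ab_group_add \<Rightarrow> 'w"
  assumes fd: "finite_dimensional_vector_space scale Basis" and \<sigma>: "involutory_automorphism \<sigma>"
    and f: "hermitian_form scale \<sigma> f" and nondeg: "nondegenerate f"
    and witt: "isotropic_spaces scale (Sesquilinear f) n \<noteq> {}"
      "\<And>i. isotropic_spaces scale (Sesquilinear f) i \<noteq> {} \<Longrightarrow> i \<le> n"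
  shows "polar_space scale Basis (\<lambda>x y. f x y = 0) (\<lambda>x. f x x = 0) n"
    and "isotropic_spaces scale (Sesquilinear f) i =
      orthogonality.TI scale (\<lambda>x y. f x y = 0) (\<lambda>x. f x x = 0) i"
proof -
  have s: "sesquilinear scale \<sigma> f" and herm: "f y x = \<sigma> (f x y)" for x y
    using f unfolding hermitian_form_def by blast+
  have f_add: "f x (y + z) = f x y + f x z" and f_scale: "f x (scale c y) = \<sigma> c * f x y"
    and f_add': "f (x + y) z = f x z + f y z" and f_scale': "f (scale c x) y = c * f x y" for x y z c
    using s by (auto simp: sesquilinear_def)
  have aut: "field_automorphism \<sigma>" using \<sigma> by (simp add: involutory_automorphism_def)
  have add: "\<sigma> (a + b) = \<sigma> a + \<sigma> b" and mult: "\<sigma> (a * b) = \<sigma> a * \<sigma> b"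
    and invol: "\<sigma> (\<sigma> a) = a" for a b
    using \<sigma> by (auto simp: involutory_automorphism_def field_automorphism_def fun_eq_iff)
  have zero: "\<sigma> 0 = 0" using add[of 0 0] by (metis add_0_right add_left_cancel)
  have eq0: "\<sigma> a = 0 \<longleftrightarrow> a = 0" for a using invol[of a] zero by metis
  define orth where "orth x y \<longleftrightarrow> f x y = 0" for x y
  define sing where "sing x \<longleftrightarrow> f x x = 0" for x
  have refl: "\<forall>x y. f x y = 0 \<longrightarrow> f y x = 0" using herm zero by metis
  note o = sesquilinear_orthogonality[OF fd s aut refl, folded sing_def, folded orth_def]
  interpret orthogonality scale Basis orth sing by (rule o(1))
  have "polar_space scale Basis orth sing n"
  proof
    show "TI n \<noteq> {}" "TI i \<noteq> {} \<Longrightarrow> i \<le> n" for i using witt o(2) by auto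
    show "\<exists>y. sing y \<and> \<not> orth x y" if x: "sing x" "x \<noteq> 0" for x
    proof -
      obtain y where y: "f x y \<noteq> 0" using nondeg x by (auto simp: nondegenerate_def)
      obtain u where u: "u + \<sigma> u = 1" using trace_one[OF \<sigma>] by blast
      \<comment> \<open>As \<open>u\<close> has trace 1 and \<open>f y y\<close> is fixed by
        \<open>\<sigma>\<close>, the trace of \<open>a\<close> is \<open>- f y y\<close>. This
        cancels \<open>f y y\<close> in the value at \<open>y + scale (a / f x y) x\<close>.\<close>
      define a where "a = - (u * f y y)"
      have fyy: "\<sigma> (f y y) = f y y" using herm[of y y] by simp
      have neg: "\<sigma> (- b) = - \<sigma> b" for b using add[of "- b" b] zero by (simp add: eq_neg_iff_add_eq_0)
      have "a + \<sigma> a = - ((u + \<sigma> u) * f y y)" by (simp add: a_def neg mult fyy distrib_right)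
      then have a: "a + \<sigma> a = - f y y" by (simp add: u)
      let ?c = "a / f x y"
      have c: "?c * f x y = a" using y by simp
      have "\<sigma> ?c * f y x = \<sigma> a" using mult[of ?c "f x y"] unfolding c herm[of y x] by simp
      then have "f (y + scale ?c x) (y + scale ?c x) = f y y + (a + \<sigma> a)"
        using c x(1) by (simp add: f_add f_add' f_scale f_scale' sing_def algebra_simps)
      then have "sing (y + scale ?c x)" by (simp add: a sing_def)
      moreover have "\<not> orth x (y + scale ?c x)"
        using y x by (simp add: orth_def f_add f_scale sing_def)
      ultimately show ?thesis by blast
    qed
    fix A e f'
    assume ef: "sing e" "sing f'" "perp A {e, f'}" "\<not> orth e f'"
    \<comment> \<open>What is wanted is a non-zero \<open>t\<close> of trace zero: if
      \<open>c * f f' e = t\<close>, then the value at \<open>e + scale c f'\<close> is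
      \<open>t + \<sigma> t = 0\<close>, while \<open>t \<noteq> 0\<close> keeps \<open>c\<close>
      non-zero and the sum non-orthogonal to \<open>e\<close>.\<close>
    obtain a where a: "\<sigma> a \<noteq> a" using \<sigma> by (auto simp: involutory_automorphism_def fun_eq_iff)
    define t where "t = a - \<sigma> a"
    have t: "t \<noteq> 0" "t + \<sigma> t = 0"
    proof -
      show "t \<noteq> 0" using a by (simp add: t_def)
      have "\<sigma> t + \<sigma> (\<sigma> a) = \<sigma> a" using add[of t "\<sigma> a"] by (simp add: t_def)
      then show "t + \<sigma> t = 0" by (simp add: invol t_def algebra_simps)
    qed
    have nz: "f e f' \<noteq> 0" "f f' e \<noteq> 0" using ef(4) herm[of f' e] eq0 by (auto simp: orth_def)
    let ?c = "t / f f' e"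
    have c: "?c * f f' e = t" "?c \<noteq> 0" using nz t by auto
    have "\<sigma> ?c * f e f' = \<sigma> t" using mult[of ?c "f f' e"] unfolding c(1) herm[of e f'] by simp
    then have "f (e + scale ?c f') (e + scale ?c f') = t + \<sigma> t"
      using c(1) ef(1,2) by (simp add: f_add f_add' f_scale f_scale' sing_def)
    then have "sing (e + scale ?c f')" by (simp add: t sing_def)
    moreover have "\<not> orth e (e + scale ?c f')" "\<not> orth f' (e + scale ?c f')"
      using nz c(2) ef(1,2) by (simp_all add: orth_def f_add f_scale sing_def eq0 t)
    moreover have "perp A {e + scale ?c f'}"
      using ef(3) by (auto simp: perp_def intro!: orth_add orth_scale)
    ultimately show "\<exists>g. sing g \<and> perp A {g} \<and> \<not> orth e g \<and> \<not> orth f' g" by blast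
  qed
  then show "polar_space scale Basis (\<lambda>x y. f x y = 0) (\<lambda>x. f x x = 0) n"
    unfolding orth_def sing_def .
  show "isotropic_spaces scale (Sesquilinear f) i =
      orthogonality.TI scale (\<lambda>x y. f x y = 0) (\<lambda>x. f x x = 0) i"
    using o(2) unfolding orth_def sing_def .
qed

lemma polar_form_polar_space:
  fixes scale :: "'f::field \<Rightarrow> 'w::ab_group_add \<Rightarrow> 'w"
  assumes "polar_form scale T n \<phi>" "1 \<le> n"
  obtains Basis orth sing where "polar_space scale Basis orth sing n"
    "\<forall>i. isotropic_spaces scale \<phi> i = orthogonality.TI scale orth sing i"
proof -
  obtain Basis where fd: "finite_dimensional_vector_space scale Basis"
    and form: "form_of_type scale T n \<phi>" and w: "witt_index scale \<phi> = n"
    using assms by (auto simp: polar_form_def)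
  have witt: "isotropic_spaces scale \<phi> n \<noteq> {}"
    "\<And>i. isotropic_spaces scale \<phi> i \<noteq> {} \<Longrightarrow> i \<le> n"
    using w witt_index_iff[OF fd form] by auto
  \<comment> \<open>The five types fall into three kinds of form. Dimension \<open>2 * n + 1\<close>
    or \<open>2 * n + 2\<close> in the orthogonal types gives the inequality on which
    \<open>quadratic_polar_space\<close> bases thickness.\<close>
  consider (Q) q where "\<phi> = Quadratic q" "quadratic_form scale q" "nondegenerate_quadratic q"
      "2 * n < vector_space.dim scale (UNIV :: 'w set)"
    | (A) f where "\<phi> = Sesquilinear f" "alternating_form scale f" "nondegenerate f"
    | (H) \<sigma> f where "\<phi> = Sesquilinear f" "involutory_automorphism \<sigma>" "hermitian_form scale \<sigma> f" "nondegenerate f"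
    using form by (cases T) auto
  then show ?thesis
  proof cases
    case Q
    have P: "polar_space scale Basis (\<lambda>x y. associated_bilinear q x y = 0) (\<lambda>x. q x = 0) n"
      by (rule quadratic_polar_space[OF fd Q(2,3) assms(2) Q(4)]) (use witt Q(1) in blast)+
    show ?thesis
      by (rule that[OF P]) (simp only: Q(1) quadratic_orthogonality(2)[OF fd Q(2)] simp_thms)
  next
    case A
    note P = alternating_polar_space[OF fd A(2,3), of n, folded A(1)]
    show ?thesis by (rule that[OF P(1)]; use witt P(2) in blast)
  next
    case H
    note P = hermitian_polar_space[OF fd H(2-4), of n, folded H(1)]
    show ?thesis by (rule that[OF P(1)]; use witt P(2) in blast)
  qed
qed

theorem corollary6p2:
  fixes scale :: "'f::field \<Rightarrow> 'w::ab_group_add \<Rightarrow> 'w"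
    and \<phi> :: "('f, 'w) form" and T :: polar_type and n k :: nat
  assumes "n \<ge> 3" and "1 \<le> k" and "k \<le> n"
    and "polar_form scale T n \<phi>"
    and "\<not> (T = Parabolic \<and> n = 4 \<and> k = 2)"
    and "\<not> (T = Elliptic \<and> n = 4 \<and> k = 2)"
  shows "Aut_grassmannian scale \<phi> n k \<cong> Aut_building scale \<phi> n"
proof -
  have n: "1 \<le> n" "1 < n" using assms(1) by auto
  obtain Basis orth sing where "polar_space scale Basis orth sing n"
    and TI: "\<forall>i. isotropic_spaces scale \<phi> i = orthogonality.TI scale orth sing i"
    using polar_form_polar_space[OF assms(4) n(1)] .
  then interpret polar_space scale Basis orth sing n by simp
  show ?thesis using Aut_grassmannian_iso[OF assms(2,3) n(2)] TI by simp
qed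

end
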